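(* $\mathbf{INF}^\iota$ is equivalent to $\mathbf{INF}^{LL\Delta}$ in the following sense: (a) if $\Gamma\vdash A$ in $\mathbf{INF}^\iota$, then $\upsilon(\Gamma)\vdash\upsilon(A)$ in $\mathbf{INF}^{LL\Delta}$; (b) if $\Gamma\vdash A$ in $\mathbf{INF}^{LL\Delta}$, then $\tau(\Gamma)\vdash\tau(A)$ in $\mathbf{INF}^\iota$, where $\tau$ and $\upsilon$ are the translations described below and $\tau(\Gamma),\upsilon(\Gamma)$ denote the sets of translated formulas of $\Gamma$.
   Context: $\mathbf{INF}$ (intuitionist negative free logic) is a natural deduction system for a first-order language with predicate letters, identity $=$, a unary existence predicate $\exists!$ applicable to terms, connectives $\land,\lor,\rightarrow,\leftrightarrow,\bot$ (with $\neg A$ as $A\rightarrow\bot$) and quantifiers $\forall,\exists$. $A^x_t$ denotes substitution of $t$ for free $x$ in $A$. Rules: the usual intuitionistic rules for $\land,\lor,\rightarrow,\leftrightarrow$; $\bot E$ restricted to atomic conclusions; $\forall I$: from a derivation of $A^x_y$ in which the only open assumption containing $y$ free is $\exists!y$, infer $\forall xA$ discharging $\exists!y$; $\forall E$: from $\forall xA$ and $\exists!t$ infer $A^x_t$; $\exists I$: from $A^x_t$ and $\exists!t$ infer $\exists xA$; $\exists E$: from $\exists xA$ and a derivation of $C$ from $A^x_y,\exists!y$ infer $C$ discharging them (usual eigenvariable conditions); $=I^n$: from $\exists!t$ infer $t=t$; $=E$: from $t_1=t_2$ and atomic $A^x_{t_1}$ infer $A^x_{t_2}$; $AD$: from an atomic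 $Pt_1\dots t_n$ (including identities) infer $\exists!t_i$. $\mathbf{INF}^\iota$: $\mathbf{INF}$ extended by a binary quantifier $\iota$ forming formulas $\iota x[F,G]$ ("the $F$ is $G$", binding $x$ in $F$ and $G$), with rules: $\iota I$: from $F^x_t$, $G^x_t$, $\exists!t$ and a derivation of $z=t$ from assumptions $F^x_z,\exists!z$ ($z$ distinct from $x$, not free in $t$ or in other open assumptions), infer $\iota x[F,G]$ discharging them; $\iota E^1$: from $\iota x[F,G]$ and a derivation of $C$ from $F^x_z,G^x_z,\exists!z$ infer $C$ discharging them ($z$ not free in $C$ or other open assumptions; $z=x$ or $z$ not free in $F,G$); $\iota E^2$: from $\iota x[F,G]$, $\exists!t_1$, $\exists!t_2$, $F^x_{t_1}$, $F^x_{t_2}$ infer $t_1=t_2$. $\mathbf{INF}^{LL\Delta}$: the language of $\mathbf{INF}$ extended by a term-forming description operator $\iota$ (terms $\iota xA$) and a predicate abstraction operator $\Delta$ forming unary predicate terms $\Delta xB$ from formulas $B$, with formulas $\Delta xB, t$ ("$t$ is $B$") for any term $t$; only unary abstraction is considered. Primary occurrences of $\iota$-terms are those flanking $=$. The system is $\mathbf{INF}$ plus the axiom schemas: Lambert's Law $\forall y(\iota xA=y\leftrightarrow\forall x(A\leftrightarrow x=y))$; $(\Delta t)$ $\Delta xB,t\leftrightarrow(\exists!t\land B^x_t)$ ($t$ free for $x$ in $B$, $x$ not free in $t$); $(\Delta\iota)$ $\Delta xB,\iota xA\leftrightarrow\exists z(\iota xA=z\land B^x_z)$. Translation $\tau$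 from the language of $\mathbf{INF}^{LL\Delta}$ to that of $\mathbf{INF}^\iota$: atomic formulas without $\iota$-terms are unchanged; $\tau$ commutes with $\neg,\forall,\exists$ and binary connectives; $\tau(\iota xA=t)=\iota x[\tau(A),x=t]$, similarly for $t=\iota xA$ (so $\tau(\iota xA=\iota yB)=\iota x[\tau(A),\iota y[\tau(B),x=y]]$); if $t$ is not an $\iota$-term, $\tau(\Delta xB,t)=\iota x[t=x,\tau(B)]$; $\tau(\Delta xB,\iota xA)=\iota x[\tau(A),\tau(B)]$. Translation $\upsilon$ from the language of $\mathbf{INF}^\iota$ to that of $\mathbf{INF}^{LL\Delta}$: unchanged on atomic formulas, commuting with the connectives and quantifiers, and $\upsilon(\iota x[A,B])=\Delta x\,\upsilon(B),\iota x\,\upsilon(A)$.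
   Formalization: Since τ is given no value on formulas where an ι-term is an argument of a predicate letter or of ∃! (e.g. ∃!ιxA), part (b) is stated for Γ and A in which ι-terms occur only flanking = or as subject of Δ; the derivation itself may use arbitrary formulas. *)

theory Defs
  imports Main
begin

(* Bound variables are de Bruijn indices, so formulas are taken up to renaming of bound variables,
   "t is free for x in A" holds automatically, and "x is not free in t" is expressed by weakening
   t with the renaming Suc.  An eigenvariable is index 0 over a weakened context; the weakening is
   what guarantees that it does not occur free in the remaining open assumptions (or in the
   conclusion of an elimination).  The comments write x for the variable with index 0. *)

definition up :: "(nat \<Rightarrow> nat) \<Rightarrow> nat \<Rightarrow> nat" where
  "up r = case_nat 0 (\<lambda>i. Suc (r i))"

section \<open>Intuitionist negative free logic with the binary quantifier\<close>

datatype 'c itm = IVar nat | ICon 'c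

(* A predicate letter is given by its name together with the number of its arguments.
   IIota F G binds index 0 in both F and G: "the F is G". *)
datatype ('c, 'p) ifm =
    IPred 'p "'c itm list"
  | IEq "'c itm" "'c itm"
  | IExi "'c itm"
  | IBot
  | IAnd "('c, 'p) ifm" "('c, 'p) ifm"
  | IOr "('c, 'p) ifm" "('c, 'p) ifm"
  | IImp "('c, 'p) ifm" "('c, 'p) ifm"
  | IIff "('c, 'p) ifm" "('c, 'p) ifm"
  | IAll "('c, 'p) ifm"
  | IEx "('c, 'p) ifm"
  | IIota "('c, 'p) ifm" "('c, 'p) ifm"

primrec iren_tm :: "(nat \<Rightarrow> nat) \<Rightarrow> 'c itm \<Rightarrow> 'c itm" where
  "iren_tm r (IVar i) = IVar (r i)"
| "iren_tm r (ICon c) = ICon c"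

primrec iren :: "(nat \<Rightarrow> nat) \<Rightarrow> ('c, 'p) ifm \<Rightarrow> ('c, 'p) ifm" where
  "iren r (IPred p ts) = IPred p (map (iren_tm r) ts)"
| "iren r (IEq s t) = IEq (iren_tm r s) (iren_tm r t)"
| "iren r (IExi t) = IExi (iren_tm r t)"
| "iren r IBot = IBot"
| "iren r (IAnd A B) = IAnd (iren r A) (iren r B)"
| "iren r (IOr A B) = IOr (iren r A) (iren r B)"
| "iren r (IImp A B) = IImp (iren r A) (iren r B)"
| "iren r (IIff A B) = IIff (iren r A) (iren r B)"
| "iren r (IAll A) = IAll (iren (up r) A)"
| "iren r (IEx A) = IEx (iren (up r) A)"
| "iren r (IIota F G) = IIota (iren (up r) F) (iren (up r) G)"

primrec isub_tm :: "(nat \<Rightarrow> 'c itm) \<Rightarrow> 'c itm \<Rightarrow> 'c itm" where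
  "isub_tm s (IVar i) = s i"
| "isub_tm s (ICon c) = ICon c"

definition iup :: "(nat \<Rightarrow> 'c itm) \<Rightarrow> nat \<Rightarrow> 'c itm" where
  "iup s = case_nat (IVar 0) (\<lambda>i. iren_tm Suc (s i))"

primrec isub :: "(nat \<Rightarrow> 'c itm) \<Rightarrow> ('c, 'p) ifm \<Rightarrow> ('c, 'p) ifm" where
  "isub s (IPred p ts) = IPred p (map (isub_tm s) ts)"
| "isub s (IEq t u) = IEq (isub_tm s t) (isub_tm s u)"
| "isub s (IExi t) = IExi (isub_tm s t)"
| "isub s IBot = IBot"
| "isub s (IAnd A B) = IAnd (isub s A) (isub s B)"
| "isub s (IOr A B) = IOr (isub s A) (isub s B)"
| "isub s (IImp A B) = IImp (isub s A) (isub s B)"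
| "isub s (IIff A B) = IIff (isub s A) (isub s B)"
| "isub s (IAll A) = IAll (isub (iup s) A)"
| "isub s (IEx A) = IEx (isub (iup s) A)"
| "isub s (IIota F G) = IIota (isub (iup s) F) (isub (iup s) G)"

abbreviation ilift_tm :: "'c itm \<Rightarrow> 'c itm" where
  "ilift_tm \<equiv> iren_tm Suc"

abbreviation ilift :: "('c, 'p) ifm \<Rightarrow> ('c, 'p) ifm" where
  "ilift \<equiv> iren Suc"

(* A with t for x; the variables other than x move down by one. *)
definition iinst :: "'c itm \<Rightarrow> ('c, 'p) ifm \<Rightarrow> ('c, 'p) ifm" where
  "iinst t = isub (case_nat t IVar)"

fun iatomic :: "('c, 'p) ifm \<Rightarrow> bool" where
  "iatomic (IPred p ts) = True"
| "iatomic (IEq s t) = True"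
| "iatomic (IExi t) = True"
| "iatomic _ = False"

inductive iderives :: "('c, 'p) ifm set \<Rightarrow> ('c, 'p) ifm \<Rightarrow> bool" (infix "\<turnstile>\<^sub>i" 40) where
  iAssm: "A \<in> \<Gamma> \<Longrightarrow> \<Gamma> \<turnstile>\<^sub>i A"
| iAndI: "\<Gamma> \<turnstile>\<^sub>i A \<Longrightarrow> \<Gamma> \<turnstile>\<^sub>i B \<Longrightarrow> \<Gamma> \<turnstile>\<^sub>i IAnd A B"
| iAndE1: "\<Gamma> \<turnstile>\<^sub>i IAnd A B \<Longrightarrow> \<Gamma> \<turnstile>\<^sub>i A"
| iAndE2: "\<Gamma> \<turnstile>\<^sub>i IAnd A B \<Longrightarrow> \<Gamma> \<turnstile>\<^sub>i B"
| iOrI1: "\<Gamma> \<turnstile>\<^sub>i A \<Longrightarrow> \<Gamma> \<turnstile>\<^sub>i IOr A B"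
| iOrI2: "\<Gamma> \<turnstile>\<^sub>i B \<Longrightarrow> \<Gamma> \<turnstile>\<^sub>i IOr A B"
| iOrE: "\<Gamma> \<turnstile>\<^sub>i IOr A B \<Longrightarrow> insert A \<Gamma> \<turnstile>\<^sub>i C \<Longrightarrow> insert B \<Gamma> \<turnstile>\<^sub>i C \<Longrightarrow> \<Gamma> \<turnstile>\<^sub>i C"
| iImpI: "insert A \<Gamma> \<turnstile>\<^sub>i B \<Longrightarrow> \<Gamma> \<turnstile>\<^sub>i IImp A B"
| iImpE: "\<Gamma> \<turnstile>\<^sub>i IImp A B \<Longrightarrow> \<Gamma> \<turnstile>\<^sub>i A \<Longrightarrow> \<Gamma> \<turnstile>\<^sub>i B"
| iIffI: "insert A \<Gamma> \<turnstile>\<^sub>i B \<Longrightarrow> insert B \<Gamma> \<turnstile>\<^sub>i A \<Longrightarrow> \<Gamma> \<turnstile>\<^sub>i IIff A B"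
| iIffE1: "\<Gamma> \<turnstile>\<^sub>i IIff A B \<Longrightarrow> \<Gamma> \<turnstile>\<^sub>i A \<Longrightarrow> \<Gamma> \<turnstile>\<^sub>i B"
| iIffE2: "\<Gamma> \<turnstile>\<^sub>i IIff A B \<Longrightarrow> \<Gamma> \<turnstile>\<^sub>i B \<Longrightarrow> \<Gamma> \<turnstile>\<^sub>i A"
| iBotE: "\<Gamma> \<turnstile>\<^sub>i IBot \<Longrightarrow> iatomic A \<Longrightarrow> \<Gamma> \<turnstile>\<^sub>i A"
| iAllI: "insert (IExi (IVar 0)) (ilift ` \<Gamma>) \<turnstile>\<^sub>i A \<Longrightarrow> \<Gamma> \<turnstile>\<^sub>i IAll A"
| iAllE: "\<Gamma> \<turnstile>\<^sub>i IAll A \<Longrightarrow> \<Gamma> \<turnstile>\<^sub>i IExi t \<Longrightarrow> \<Gamma> \<turnstile>\<^sub>i iinst t A"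
| iExI: "\<Gamma> \<turnstile>\<^sub>i iinst t A \<Longrightarrow> \<Gamma> \<turnstile>\<^sub>i IExi t \<Longrightarrow> \<Gamma> \<turnstile>\<^sub>i IEx A"
| iExE: "\<Gamma> \<turnstile>\<^sub>i IEx A \<Longrightarrow> insert A (insert (IExi (IVar 0)) (ilift ` \<Gamma>)) \<turnstile>\<^sub>i ilift C \<Longrightarrow> \<Gamma> \<turnstile>\<^sub>i C"
| iEqI: "\<Gamma> \<turnstile>\<^sub>i IExi t \<Longrightarrow> \<Gamma> \<turnstile>\<^sub>i IEq t t"
| iEqE: "\<Gamma> \<turnstile>\<^sub>i IEq t u \<Longrightarrow> iatomic A \<Longrightarrow> \<Gamma> \<turnstile>\<^sub>i iinst t A \<Longrightarrow> \<Gamma> \<turnstile>\<^sub>i iinst u A"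
| iAD: "\<Gamma> \<turnstile>\<^sub>i IPred p ts \<Longrightarrow> t \<in> set ts \<Longrightarrow> \<Gamma> \<turnstile>\<^sub>i IExi t"
| iADEq1: "\<Gamma> \<turnstile>\<^sub>i IEq t u \<Longrightarrow> \<Gamma> \<turnstile>\<^sub>i IExi t"
| iADEq2: "\<Gamma> \<turnstile>\<^sub>i IEq t u \<Longrightarrow> \<Gamma> \<turnstile>\<^sub>i IExi u"
| iIotaI: "\<Gamma> \<turnstile>\<^sub>i iinst t F \<Longrightarrow> \<Gamma> \<turnstile>\<^sub>i iinst t G \<Longrightarrow> \<Gamma> \<turnstile>\<^sub>i IExi t \<Longrightarrow>
    insert F (insert (IExi (IVar 0)) (ilift ` \<Gamma>)) \<turnstile>\<^sub>i IEq (IVar 0) (ilift_tm t) \<Longrightarrow> \<Gamma> \<turnstile>\<^sub>i IIota F G"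
| iIotaE1: "\<Gamma> \<turnstile>\<^sub>i IIota F G \<Longrightarrow>
    insert F (insert G (insert (IExi (IVar 0)) (ilift ` \<Gamma>))) \<turnstile>\<^sub>i ilift C \<Longrightarrow> \<Gamma> \<turnstile>\<^sub>i C"
| iIotaE2: "\<Gamma> \<turnstile>\<^sub>i IIota F G \<Longrightarrow> \<Gamma> \<turnstile>\<^sub>i IExi t \<Longrightarrow> \<Gamma> \<turnstile>\<^sub>i IExi u \<Longrightarrow>
    \<Gamma> \<turnstile>\<^sub>i iinst t F \<Longrightarrow> \<Gamma> \<turnstile>\<^sub>i iinst u F \<Longrightarrow> \<Gamma> \<turnstile>\<^sub>i IEq t u"

section \<open>Intuitionist negative free logic with description terms and predicate abstraction\<close>

(* The A binds index 0 in A.  LDelta B t binds index 0 in B but not in t: "t is B". *)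
datatype ('c, 'p) ltm = LVar nat | LCon 'c | is_The: The "('c, 'p) lfm"
  and ('c, 'p) lfm =
    LPred 'p "('c, 'p) ltm list"
  | LEq "('c, 'p) ltm" "('c, 'p) ltm"
  | LExi "('c, 'p) ltm"
  | LBot
  | LAnd "('c, 'p) lfm" "('c, 'p) lfm"
  | LOr "('c, 'p) lfm" "('c, 'p) lfm"
  | LImp "('c, 'p) lfm" "('c, 'p) lfm"
  | LIff "('c, 'p) lfm" "('c, 'p) lfm"
  | LAll "('c, 'p) lfm"
  | LEx "('c, 'p) lfm"
  | LDelta "('c, 'p) lfm" "('c, 'p) ltm"

primrec lren_tm :: "(nat \<Rightarrow> nat) \<Rightarrow> ('c, 'p) ltm \<Rightarrow> ('c, 'p) ltm"
  and lren :: "(nat \<Rightarrow> nat) \<Rightarrow> ('c, 'p) lfm \<Rightarrow> ('c, 'p) lfm" where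
  "lren_tm r (LVar i) = LVar (r i)"
| "lren_tm r (LCon c) = LCon c"
| "lren_tm r (The A) = The (lren (up r) A)"
| "lren r (LPred p ts) = LPred p (map (lren_tm r) ts)"
| "lren r (LEq s t) = LEq (lren_tm r s) (lren_tm r t)"
| "lren r (LExi t) = LExi (lren_tm r t)"
| "lren r LBot = LBot"
| "lren r (LAnd A B) = LAnd (lren r A) (lren r B)"
| "lren r (LOr A B) = LOr (lren r A) (lren r B)"
| "lren r (LImp A B) = LImp (lren r A) (lren r B)"
| "lren r (LIff A B) = LIff (lren r A) (lren r B)"
| "lren r (LAll A) = LAll (lren (up r) A)"
| "lren r (LEx A) = LEx (lren (up r) A)"
| "lren r (LDelta B t) = LDelta (lren (up r) B) (lren_tm r t)"

definition lup :: "(nat \<Rightarrow> ('c, 'p) ltm) \<Rightarrow> nat \<Rightarrow> ('c, 'p) ltm" where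
  "lup s = case_nat (LVar 0) (\<lambda>i. lren_tm Suc (s i))"

primrec lsub_tm :: "(nat \<Rightarrow> ('c, 'p) ltm) \<Rightarrow> ('c, 'p) ltm \<Rightarrow> ('c, 'p) ltm"
  and lsub :: "(nat \<Rightarrow> ('c, 'p) ltm) \<Rightarrow> ('c, 'p) lfm \<Rightarrow> ('c, 'p) lfm" where
  "lsub_tm s (LVar i) = s i"
| "lsub_tm s (LCon c) = LCon c"
| "lsub_tm s (The A) = The (lsub (lup s) A)"
| "lsub s (LPred p ts) = LPred p (map (lsub_tm s) ts)"
| "lsub s (LEq t u) = LEq (lsub_tm s t) (lsub_tm s u)"
| "lsub s (LExi t) = LExi (lsub_tm s t)"
| "lsub s LBot = LBot"
| "lsub s (LAnd A B) = LAnd (lsub s A) (lsub s B)"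
| "lsub s (LOr A B) = LOr (lsub s A) (lsub s B)"
| "lsub s (LImp A B) = LImp (lsub s A) (lsub s B)"
| "lsub s (LIff A B) = LIff (lsub s A) (lsub s B)"
| "lsub s (LAll A) = LAll (lsub (lup s) A)"
| "lsub s (LEx A) = LEx (lsub (lup s) A)"
| "lsub s (LDelta B t) = LDelta (lsub (lup s) B) (lsub_tm s t)"

abbreviation llift_tm :: "('c, 'p) ltm \<Rightarrow> ('c, 'p) ltm" where
  "llift_tm \<equiv> lren_tm Suc"

abbreviation llift :: "('c, 'p) lfm \<Rightarrow> ('c, 'p) lfm" where
  "llift \<equiv> lren Suc"

definition linst :: "('c, 'p) ltm \<Rightarrow> ('c, 'p) lfm \<Rightarrow> ('c, 'p) lfm" where
  "linst t = lsub (case_nat t LVar)"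

(* Nothing depends on not counting LDelta as atomic: with lDeltaT and lDeltaIota below the rules
   restricted to atomic formulas are derivable for it. *)
fun latomic :: "('c, 'p) lfm \<Rightarrow> bool" where
  "latomic (LPred p ts) = True"
| "latomic (LEq s t) = True"
| "latomic (LExi t) = True"
| "latomic _ = False"

(* In lLL, index 0 of A is x and index 1 is the outer variable y, both in "The A" and under the
   inner quantifier, so the same A occurs on both sides.  In lDeltaIota, A is moved into the scope
   of the existential quantifier and is therefore weakened, whereas index 0 of B is the variable
   that becomes bound by that quantifier. *)
inductive lderives :: "('c, 'p) lfm set \<Rightarrow> ('c, 'p) lfm \<Rightarrow> bool" (infix "\<turnstile>\<^sub>l" 40) where
  lAssm: "A \<in> \<Gamma> \<Longrightarrow> \<Gamma> \<turnstile>\<^sub>l A"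
| lAndI: "\<Gamma> \<turnstile>\<^sub>l A \<Longrightarrow> \<Gamma> \<turnstile>\<^sub>l B \<Longrightarrow> \<Gamma> \<turnstile>\<^sub>l LAnd A B"
| lAndE1: "\<Gamma> \<turnstile>\<^sub>l LAnd A B \<Longrightarrow> \<Gamma> \<turnstile>\<^sub>l A"
| lAndE2: "\<Gamma> \<turnstile>\<^sub>l LAnd A B \<Longrightarrow> \<Gamma> \<turnstile>\<^sub>l B"
| lOrI1: "\<Gamma> \<turnstile>\<^sub>l A \<Longrightarrow> \<Gamma> \<turnstile>\<^sub>l LOr A B"
| lOrI2: "\<Gamma> \<turnstile>\<^sub>l B \<Longrightarrow> \<Gamma> \<turnstile>\<^sub>l LOr A B"
| lOrE: "\<Gamma> \<turnstile>\<^sub>l LOr A B \<Longrightarrow> insert A \<Gamma> \<turnstile>\<^sub>l C \<Longrightarrow> insert B \<Gamma> \<turnstile>\<^sub>l C \<Longrightarrow> \<Gamma> \<turnstile>\<^sub>l C"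
| lImpI: "insert A \<Gamma> \<turnstile>\<^sub>l B \<Longrightarrow> \<Gamma> \<turnstile>\<^sub>l LImp A B"
| lImpE: "\<Gamma> \<turnstile>\<^sub>l LImp A B \<Longrightarrow> \<Gamma> \<turnstile>\<^sub>l A \<Longrightarrow> \<Gamma> \<turnstile>\<^sub>l B"
| lIffI: "insert A \<Gamma> \<turnstile>\<^sub>l B \<Longrightarrow> insert B \<Gamma> \<turnstile>\<^sub>l A \<Longrightarrow> \<Gamma> \<turnstile>\<^sub>l LIff A B"
| lIffE1: "\<Gamma> \<turnstile>\<^sub>l LIff A B \<Longrightarrow> \<Gamma> \<turnstile>\<^sub>l A \<Longrightarrow> \<Gamma> \<turnstile>\<^sub>l B"
| lIffE2: "\<Gamma> \<turnstile>\<^sub>l LIff A B \<Longrightarrow> \<Gamma> \<turnstile>\<^sub>l B \<Longrightarrow> \<Gamma> \<turnstile>\<^sub>l A"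
| lBotE: "\<Gamma> \<turnstile>\<^sub>l LBot \<Longrightarrow> latomic A \<Longrightarrow> \<Gamma> \<turnstile>\<^sub>l A"
| lAllI: "insert (LExi (LVar 0)) (llift ` \<Gamma>) \<turnstile>\<^sub>l A \<Longrightarrow> \<Gamma> \<turnstile>\<^sub>l LAll A"
| lAllE: "\<Gamma> \<turnstile>\<^sub>l LAll A \<Longrightarrow> \<Gamma> \<turnstile>\<^sub>l LExi t \<Longrightarrow> \<Gamma> \<turnstile>\<^sub>l linst t A"
| lExI: "\<Gamma> \<turnstile>\<^sub>l linst t A \<Longrightarrow> \<Gamma> \<turnstile>\<^sub>l LExi t \<Longrightarrow> \<Gamma> \<turnstile>\<^sub>l LEx A"
| lExE: "\<Gamma> \<turnstile>\<^sub>l LEx A \<Longrightarrow> insert A (insert (LExi (LVar 0)) (llift ` \<Gamma>)) \<turnstile>\<^sub>l llift C \<Longrightarrow> \<Gamma> \<turnstile>\<^sub>l C"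
| lEqI: "\<Gamma> \<turnstile>\<^sub>l LExi t \<Longrightarrow> \<Gamma> \<turnstile>\<^sub>l LEq t t"
| lEqE: "\<Gamma> \<turnstile>\<^sub>l LEq t u \<Longrightarrow> latomic A \<Longrightarrow> \<Gamma> \<turnstile>\<^sub>l linst t A \<Longrightarrow> \<Gamma> \<turnstile>\<^sub>l linst u A"
| lAD: "\<Gamma> \<turnstile>\<^sub>l LPred p ts \<Longrightarrow> t \<in> set ts \<Longrightarrow> \<Gamma> \<turnstile>\<^sub>l LExi t"
| lADEq1: "\<Gamma> \<turnstile>\<^sub>l LEq t u \<Longrightarrow> \<Gamma> \<turnstile>\<^sub>l LExi t"
| lADEq2: "\<Gamma> \<turnstile>\<^sub>l LEq t u \<Longrightarrow> \<Gamma> \<turnstile>\<^sub>l LExi u"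
| lLL: "\<Gamma> \<turnstile>\<^sub>l LAll (LIff (LEq (The A) (LVar 0)) (LAll (LIff A (LEq (LVar 0) (LVar 1)))))"
| lDeltaT: "\<Gamma> \<turnstile>\<^sub>l LIff (LDelta B t) (LAnd (LExi t) (linst t B))"
| lDeltaIota: "\<Gamma> \<turnstile>\<^sub>l LIff (LDelta B (The A)) (LEx (LAnd (LEq (llift_tm (The A)) (LVar 0)) B))"

section \<open>The translations\<close>

primrec ups_tm :: "'c itm \<Rightarrow> ('c, 'p) ltm" where
  "ups_tm (IVar i) = LVar i"
| "ups_tm (ICon c) = LCon c"

primrec ups :: "('c, 'p) ifm \<Rightarrow> ('c, 'p) lfm" where
  "ups (IPred p ts) = LPred p (map ups_tm ts)"
| "ups (IEq s t) = LEq (ups_tm s) (ups_tm t)"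
| "ups (IExi t) = LExi (ups_tm t)"
| "ups IBot = LBot"
| "ups (IAnd A B) = LAnd (ups A) (ups B)"
| "ups (IOr A B) = LOr (ups A) (ups B)"
| "ups (IImp A B) = LImp (ups A) (ups B)"
| "ups (IIff A B) = LIff (ups A) (ups B)"
| "ups (IAll A) = LAll (ups A)"
| "ups (IEx A) = LEx (ups A)"
| "ups (IIota A B) = LDelta (ups B) (The (ups A))"

(* The formulas on which tau is defined: description terms occur only next to the identity sign
   or as the subject of an abstract, never as an argument of a predicate letter or of the
   existence predicate. *)
primrec translatable_tm :: "('c, 'p) ltm \<Rightarrow> bool"
  and translatable :: "('c, 'p) lfm \<Rightarrow> bool" where
  "translatable_tm (LVar i) \<longleftrightarrow> True"
| "translatable_tm (LCon c) \<longleftrightarrow> True"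
| "translatable_tm (The A) \<longleftrightarrow> translatable A"
| "translatable (LPred p ts) \<longleftrightarrow> (\<forall>t \<in> set ts. \<not> is_The t)"
| "translatable (LEq s t) \<longleftrightarrow> translatable_tm s \<and> translatable_tm t"
| "translatable (LExi t) \<longleftrightarrow> \<not> is_The t"
| "translatable LBot \<longleftrightarrow> True"
| "translatable (LAnd A B) \<longleftrightarrow> translatable A \<and> translatable B"
| "translatable (LOr A B) \<longleftrightarrow> translatable A \<and> translatable B"
| "translatable (LImp A B) \<longleftrightarrow> translatable A \<and> translatable B"
| "translatable (LIff A B) \<longleftrightarrow> translatable A \<and> translatable B"
| "translatable (LAll A) \<longleftrightarrow> translatable A"
| "translatable (LEx A) \<longleftrightarrow> translatable A"
| "translatable (LDelta B t) \<longleftrightarrow> translatable B \<and> translatable_tm t"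

primrec tau_tm :: "('c, 'p) ltm \<Rightarrow> 'c itm" where
  "tau_tm (LVar i) = IVar i"
| "tau_tm (LCon c) = ICon c"
| "tau_tm (The A) = undefined"

(* In the first LEq clause, B keeps its own bound index 0 and is weakened only by the binder of
   A, hence the renaming up Suc.  The order of the identities in the second and third LEq clauses is the one forced by the
   value of tau on an identity between two description terms. *)
fun tau :: "('c, 'p) lfm \<Rightarrow> ('c, 'p) ifm" where
  "tau (LPred p ts) = IPred p (map tau_tm ts)"
| "tau (LEq (The A) (The B)) = IIota (tau A) (IIota (iren (up Suc) (tau B)) (IEq (IVar 1) (IVar 0)))"
| "tau (LEq (The A) t) = IIota (tau A) (IEq (IVar 0) (ilift_tm (tau_tm t)))"
| "tau (LEq s (The B)) = IIota (tau B) (IEq (ilift_tm (tau_tm s)) (IVar 0))"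
| "tau (LEq s t) = IEq (tau_tm s) (tau_tm t)"
| "tau (LExi t) = IExi (tau_tm t)"
| "tau LBot = IBot"
| "tau (LAnd A B) = IAnd (tau A) (tau B)"
| "tau (LOr A B) = IOr (tau A) (tau B)"
| "tau (LImp A B) = IImp (tau A) (tau B)"
| "tau (LIff A B) = IIff (tau A) (tau B)"
| "tau (LAll A) = IAll (tau A)"
| "tau (LEx A) = IEx (tau A)"
| "tau (LDelta B (The A)) = IIota (tau A) (tau B)"
| "tau (LDelta B t) = IIota (IEq (ilift_tm (tau_tm t)) (IVar 0)) (tau B)"

end

(* Part (a) is by induction on derivations: the two abstraction schemas and Lambert's Law turn
   "Delta G, the F" into "some z is G and everything existing is F iff it is z", and the rules for
   the binary quantifier follow.  What is needed besides is substitutivity of identicals for all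
   formulas, abstracts included.

   For part (b), tau is not defined on all formulas in a derivation, since a description term may be
   substituted for a variable in an argument of a predicate letter or of the existence predicate, and
   tau does not commute with such substitutions.  Therefore tau is replaced by a total translation
   russell, which reads every atomic formula as "there are values of its terms such that ...".
   Replacing a variable by a term whose value is u amounts, up to provable equivalence, to replacing
   it by u, so russell is sound for the whole calculus; on translatable formulas russell and tau are
   provably equivalent. *)

theory Submission
  imports Defs
begin

text \<open>The terms of the binary-quantifier language are variables and constants only, so a
  description has no name there and can be spoken of only through a variable for its value. Hence
  \<open>denotes t\<close>, a formula with the value at index 0, is the image of a term. What makes
  this work is that a value always exists (\<open>denotes_strict\<close>) and that two values of one
  term are identical (\<open>denotes_functional\<close>). The link with the binary quantifier is
  \<open>iIota_iff_Ex\<close>: \<open>IIota F G\<close> says that something is both the unique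
  \<open>F\<close> and a \<open>G\<close>, and the same formula \<open>unique F\<close> is the value
  condition for \<open>The\<close>. The obstacle is substitution: putting a term for a variable and
  putting its value for it yield formulas that are merely equivalent in a context, so the comparison
  has to be pushed under binders while free variables may fail to denote.\<close>

section \<open>The system with the binary quantifier\<close>

lemma up_simps [simp]: "up r 0 = 0" "up r (Suc i) = Suc (r i)"
  by (simp_all add: up_def)

lemma iup_simps [simp]: "iup s 0 = IVar 0" "iup s (Suc i) = iren_tm Suc (s i)"
  by (simp_all add: iup_def)

lemma iren_tm_eq_isub_tm: "iren_tm r t = isub_tm (\<lambda>i. IVar (r i)) t"
  by (cases t) simp_all

lemma isub_tm_isub_tm: "isub_tm s (isub_tm s' t) = isub_tm (\<lambda>i. isub_tm s (s' i)) t"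
  by (cases t) simp_all

lemma isub_tm_IVar: "isub_tm IVar t = t"
  by (cases t) simp_all

lemma iup_ren: "iup (\<lambda>i. IVar (r i)) = (\<lambda>i. IVar (up r i))"
  by (rule ext, rename_tac i, case_tac i) simp_all

lemma iup_comp: "iup (\<lambda>i. isub_tm s (s' i)) = (\<lambda>i. isub_tm (iup s) (iup s' i))"
  by (rule ext, rename_tac i, case_tac i) (simp_all add: iren_tm_eq_isub_tm isub_tm_isub_tm)

lemma iup_IVar: "iup IVar = IVar"
  by (rule ext, rename_tac i, case_tac i) simp_all

lemma iren_eq_isub: "iren r A = isub (\<lambda>i. IVar (r i)) A"
  by (induct A arbitrary: r) (simp_all add: iren_tm_eq_isub_tm iup_ren)

lemma isub_isub: "isub s (isub s' A) = isub (\<lambda>i. isub_tm s (s' i)) A"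
  by (induct A arbitrary: s s') (simp_all add: isub_tm_isub_tm iup_comp)

lemma isub_IVar: "isub IVar A = A"
  by (induct A) (simp_all add: isub_tm_IVar iup_IVar map_idI)

text \<open>Renamings and instances all become a single \<open>isub\<close>, so that an identity
  between substituted formulas reduces to comparing two functions on indices.\<close>

lemmas isub_norm = iinst_def iren_eq_isub isub_isub iren_tm_eq_isub_tm isub_tm_isub_tm

lemma isub_cong: "(\<And>i. s i = s' i) \<Longrightarrow> isub s A = isub s' A"
  by (metis ext)

lemma isub_tm_cong: "(\<And>i. s i = s' i) \<Longrightarrow> isub_tm s t = isub_tm s' t"
  by (metis ext)

lemma isub_idI: "(\<And>i. s i = IVar i) \<Longrightarrow> isub s A = A"
  by (metis ext isub_IVar)

lemma isub_tm_idI: "(\<And>i. s i = IVar i) \<Longrightarrow> isub_tm s t = t"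
  by (metis ext isub_tm_IVar)

lemma isub_iup_ilift: "isub (iup s) (ilift A) = ilift (isub s A)"
  by (auto simp: isub_norm intro: isub_cong)

lemma isub_tm_iup_ilift_tm: "isub_tm (iup s) (ilift_tm t) = ilift_tm (isub_tm s t)"
  by (auto simp: isub_norm intro: isub_tm_cong)

lemma isub_iinst: "isub s (iinst t A) = iinst (isub_tm s t) (isub (iup s) A)"
  by (auto simp: isub_norm isub_tm_IVar intro!: isub_cong isub_tm_idI[symmetric] split: nat.split)

lemma isub_tm_inst_ilift_tm [simp]: "isub_tm (case_nat t IVar) (ilift_tm u) = u"
  by (auto simp: isub_norm intro: isub_tm_idI)

text \<open>In a context with eigenvariable 0 the weakened \<open>IAll A\<close> has the body
  \<open>iren (up Suc) A\<close>; instantiating it with the eigenvariable itself gives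
  \<open>A\<close> back. This keeps substitutions out of eigenvariable arguments.\<close>

lemma iinst_0_up_Suc [simp]: "iinst (IVar 0) (iren (up Suc) A) = A"
  by (auto simp: isub_norm up_def intro!: isub_idI split: nat.split)

text \<open>The same one binder further in, where index 1 is the outer eigenvariable.\<close>

lemma iinst_1_up_Suc_up_Suc: "iinst (IVar 1) (iren (up Suc) (iren (up Suc) A)) = ilift A"
  by (auto simp: isub_norm up_def intro!: isub_cong split: nat.split)

lemma iatomic_isub [simp]: "iatomic (isub s A) = iatomic A"
  by (cases A) simp_all

section \<open>Closure of derivability under substitution, and derived structural rules\<close>

text \<open>Substitution and weakening in one induction: \<open>imono\<close> is the case of the
  identity substitution, \<open>iren_derives\<close> that of variables for variables. Inclusion in
  \<open>\<Delta>\<close> survives the eigenvariable rules because \<open>iup s\<close> commutes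
  with weakening.\<close>

lemma isub_derives: "\<Gamma> \<turnstile>\<^sub>i A \<Longrightarrow> isub s ` \<Gamma> \<subseteq> \<Delta> \<Longrightarrow> \<Delta> \<turnstile>\<^sub>i isub s A"
proof (induction arbitrary: s \<Delta> rule: iderives.induct)
  case (iOrE \<Gamma> A B C)
  have "insert (isub s A) \<Delta> \<turnstile>\<^sub>i isub s C" "insert (isub s B) \<Delta> \<turnstile>\<^sub>i isub s C"
    using iOrE by (auto simp: subset_insertI2)
  with iOrE show ?case by (auto intro: iderives.iOrE)
next
  case (iImpI A \<Gamma> B)
  have "insert (isub s A) \<Delta> \<turnstile>\<^sub>i isub s B" using iImpI by (auto simp: subset_insertI2)
  then show ?case by (auto intro: iderives.iImpI)
next
  case (iIffI A \<Gamma> B)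
  have "insert (isub s A) \<Delta> \<turnstile>\<^sub>i isub s B" "insert (isub s B) \<Delta> \<turnstile>\<^sub>i isub s A"
    using iIffI by (auto simp: subset_insertI2)
  then show ?case by (auto intro: iderives.iIffI)
next
  case (iAllI \<Gamma> A)
  have "insert (IExi (IVar 0)) (ilift ` \<Delta>) \<turnstile>\<^sub>i isub (iup s) A"
    using iAllI.prems by (intro iAllI.IH) (auto simp: isub_iup_ilift)
  then show ?case by (auto intro: iderives.iAllI)
next
  case (iAllE \<Gamma> A t)
  then show ?case by (simp add: isub_iinst) (metis iderives.iAllE)
next
  case (iExI \<Gamma> t A)
  then show ?case by (simp add: isub_iinst) (metis iderives.iExI)
next
  case (iExE \<Gamma> A C)
  have "insert (isub (iup s) A) (insert (IExi (IVar 0)) (ilift ` \<Delta>)) \<turnstile>\<^sub>i isub (iup s) (ilift C)"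
    using iExE.prems by (intro iExE.IH) (auto simp: isub_iup_ilift)
  with iExE show ?case by (auto simp: isub_iup_ilift intro: iderives.iExE)
next
  case (iEqE \<Gamma> t u A)
  then show ?case by (simp add: isub_iinst) (metis iderives.iEqE iatomic_isub)
next
  case (iIotaI \<Gamma> t F G)
  have "insert (isub (iup s) F) (insert (IExi (IVar 0)) (ilift ` \<Delta>))
      \<turnstile>\<^sub>i isub (iup s) (IEq (IVar 0) (ilift_tm t))"
    using iIotaI.prems by (intro iIotaI.IH) (auto simp: isub_iup_ilift)
  with iIotaI show ?case
    by (auto simp: isub_iinst isub_tm_iup_ilift_tm intro: iderives.iIotaI[of _ "isub_tm s t"])
next
  case (iIotaE1 \<Gamma> F G C)
  have "insert (isub (iup s) F) (insert (isub (iup s) G) (insert (IExi (IVar 0)) (ilift ` \<Delta>)))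
      \<turnstile>\<^sub>i isub (iup s) (ilift C)"
    using iIotaE1.prems by (intro iIotaE1.IH) (auto simp: isub_iup_ilift)
  with iIotaE1 show ?case by (auto simp: isub_iup_ilift intro: iderives.iIotaE1)
next
  case (iIotaE2 \<Gamma> F G t u)
  then show ?case by (simp add: isub_iinst) (metis iderives.iIotaE2)
next
  case (iAD \<Gamma> p ts t)
  then show ?case by (simp, metis iderives.iAD image_eqI list.set_map)
next
  case (iImpE \<Gamma> A B)
  then show ?case by simp (metis iderives.iImpE)
next
  case (iIffE1 \<Gamma> A B)
  then show ?case by simp (metis iderives.iIffE1)
next
  case (iIffE2 \<Gamma> A B)
  then show ?case by simp (metis iderives.iIffE2)
next
  case (iADEq1 \<Gamma> t u)
  then show ?case by simp (metis iderives.iADEq1)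
next
  case (iADEq2 \<Gamma> t u)
  then show ?case by simp (metis iderives.iADEq2)
qed (auto intro: iderives.intros)

lemma imono: "\<Gamma> \<turnstile>\<^sub>i A \<Longrightarrow> \<Gamma> \<subseteq> \<Delta> \<Longrightarrow> \<Delta> \<turnstile>\<^sub>i A"
  using isub_derives[of \<Gamma> A IVar \<Delta>] by (simp add: isub_IVar)

lemma iren_derives: "\<Gamma> \<turnstile>\<^sub>i A \<Longrightarrow> iren r ` \<Gamma> \<subseteq> \<Delta> \<Longrightarrow> \<Delta> \<turnstile>\<^sub>i iren r A"
  using isub_derives[of \<Gamma> A "\<lambda>i. IVar (r i)" \<Delta>] by (simp add: iren_eq_isub)

lemma icut: "\<Gamma> \<turnstile>\<^sub>i A \<Longrightarrow> insert A \<Gamma> \<turnstile>\<^sub>i B \<Longrightarrow> \<Gamma> \<turnstile>\<^sub>i B"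
  by (metis iImpI iImpE)

lemma iassm_insert [simp]: "insert A \<Gamma> \<turnstile>\<^sub>i A"
  by (simp add: iAssm)

lemma iweaken: "\<Gamma> \<turnstile>\<^sub>i A \<Longrightarrow> insert B \<Gamma> \<turnstile>\<^sub>i A"
  by (erule imono) blast

text \<open>Induction on the conclusion extends the atomic rule. For \<open>IEx\<close> and
  \<open>IIota\<close> the hypothesis is applied to an instance of a subformula, hence the arbitrary
  \<open>s\<close>. Any term can be the witness, since its existence is itself an atomic consequence
  of absurdity.\<close>

lemma iExf: "\<Gamma> \<turnstile>\<^sub>i IBot \<Longrightarrow> \<Gamma> \<turnstile>\<^sub>i A"
proof -
  have "\<Gamma> \<turnstile>\<^sub>i IBot \<Longrightarrow> \<Gamma> \<turnstile>\<^sub>i isub s A" for s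
  proof (induct A arbitrary: \<Gamma> s)
    case (IAll A)
    have "insert (IExi (IVar 0)) (ilift ` \<Gamma>) \<turnstile>\<^sub>i IBot"
      using iren_derives[OF IAll(2), of Suc] by auto
    from IAll(1)[OF this] show ?case by (auto intro: iAllI)
  next
    case (IEx A)
    then have "\<Gamma> \<turnstile>\<^sub>i iinst (IVar 0) (isub (iup s) A)" by (simp add: iinst_def isub_isub)
    moreover have "\<Gamma> \<turnstile>\<^sub>i IExi (IVar 0)" using IEx(2) by (rule iBotE) simp
    ultimately show ?case by (simp add: iExI)
  next
    case (IIota F G)
    let ?\<Delta> = "insert (isub (iup s) F) (insert (IExi (IVar 0)) (ilift ` \<Gamma>))"
    have "\<Gamma> \<turnstile>\<^sub>i iinst (IVar 0) (isub (iup s) F)" "\<Gamma> \<turnstile>\<^sub>i iinst (IVar 0) (isub (iup s) G)"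
      using IIota by (simp_all add: iinst_def isub_isub)
    moreover have "\<Gamma> \<turnstile>\<^sub>i IExi (IVar 0)" using IIota(3) by (rule iBotE) simp
    moreover have "?\<Delta> \<turnstile>\<^sub>i iren Suc IBot"
      using IIota(3) by (rule iren_derives) blast
    then have "?\<Delta> \<turnstile>\<^sub>i IEq (IVar 0) (ilift_tm (IVar 0))" by (auto intro: iBotE)
    ultimately show ?case by (simp only: isub.simps iIotaI)
  next
    case (IAnd A B)
    then show ?case by (simp add: iAndI)
  next
    case (IOr A B)
    then show ?case by (simp add: iOrI1)
  next
    case (IImp A B)
    then show ?case by (simp add: iImpI iweaken)
  next
    case (IIff A B)
    then show ?case by (simp add: iIffI iweaken)
  qed (simp_all add: iBotE)
  from this[of IVar] show "\<Gamma> \<turnstile>\<^sub>i IBot \<Longrightarrow> \<Gamma> \<turnstile>\<^sub>i A" by (simp add: isub_IVar)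
qed

section \<open>Provable equivalence and its congruence rules\<close>

lemma iIff_iff: "\<Gamma> \<turnstile>\<^sub>i IIff A B \<longleftrightarrow> insert A \<Gamma> \<turnstile>\<^sub>i B \<and> insert B \<Gamma> \<turnstile>\<^sub>i A"
  by (meson iIffI iIffE1 iIffE2 iassm_insert iweaken)

lemma iIff_refl [simp]: "\<Gamma> \<turnstile>\<^sub>i IIff A A"
  by (simp add: iIff_iff)

lemma iIff_sym: "\<Gamma> \<turnstile>\<^sub>i IIff A B \<Longrightarrow> \<Gamma> \<turnstile>\<^sub>i IIff B A"
  by (simp add: iIff_iff)

lemma iIff_trans: "\<Gamma> \<turnstile>\<^sub>i IIff A B \<Longrightarrow> \<Gamma> \<turnstile>\<^sub>i IIff B C \<Longrightarrow> \<Gamma> \<turnstile>\<^sub>i IIff A C"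
  by (meson iIffI iIffE1 iIffE2 iassm_insert iweaken)

lemma iAnd_iff: "\<Gamma> \<turnstile>\<^sub>i IAnd A B \<longleftrightarrow> \<Gamma> \<turnstile>\<^sub>i A \<and> \<Gamma> \<turnstile>\<^sub>i B"
  by (meson iAndI iAndE1 iAndE2)

lemma iAnd_commute: "\<Gamma> \<turnstile>\<^sub>i IIff (IAnd A B) (IAnd B A)"
  by (meson iIffI iAnd_iff iassm_insert)

lemma iAnd_left: "insert A (insert B \<Gamma>) \<turnstile>\<^sub>i C \<Longrightarrow> insert (IAnd A B) \<Gamma> \<turnstile>\<^sub>i C"
proof -
  assume "insert A (insert B \<Gamma>) \<turnstile>\<^sub>i C"
  then have "insert A (insert B (insert (IAnd A B) \<Gamma>)) \<turnstile>\<^sub>i C" by (rule imono) blast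
  then show ?thesis by (meson icut iAndE1 iAndE2 iassm_insert iweaken)
qed

lemma iAllE_0: "\<Gamma> \<turnstile>\<^sub>i ilift (IAll A) \<Longrightarrow> \<Gamma> \<turnstile>\<^sub>i IExi (IVar 0) \<Longrightarrow> \<Gamma> \<turnstile>\<^sub>i A"
  by (metis iAllE iinst_0_up_Suc iren.simps(9))

lemma iExI_0: "\<Gamma> \<turnstile>\<^sub>i A \<Longrightarrow> \<Gamma> \<turnstile>\<^sub>i IExi (IVar 0) \<Longrightarrow> \<Gamma> \<turnstile>\<^sub>i ilift (IEx A)"
  by (metis iExI iinst_0_up_Suc iren.simps(10))

lemma iEx_left:
  "insert A (insert (IExi (IVar 0)) (ilift ` \<Gamma>)) \<turnstile>\<^sub>i ilift C \<Longrightarrow> insert (IEx A) \<Gamma> \<turnstile>\<^sub>i C"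
  by (rule iExE[OF iassm_insert]) (erule imono, blast)

lemma iren_up_ilift: "iren (up r) (ilift A) = ilift (iren r A)"
  by (auto simp: isub_norm intro: isub_cong)

text \<open>Repeats an argument about one eigenvariable for a second one introduced inside it:
  \<open>up Suc\<close> keeps index 0 and steps over the first eigenvariable, now index 1.\<close>

lemma iren_up_derives:
  "insert (IExi (IVar 0)) (ilift ` \<Gamma>) \<turnstile>\<^sub>i A \<Longrightarrow> ilift ` \<Gamma> \<subseteq> \<Delta> \<Longrightarrow>
   insert (IExi (IVar 0)) (ilift ` \<Delta>) \<turnstile>\<^sub>i iren (up Suc) A"
  by (erule iren_derives) (auto simp: iren_up_ilift)

text \<open>The weakened description formula stays available beside what \<open>iIotaE1\<close>
  supplies, because the uniqueness of the described object still has to be drawn from it by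
  \<open>iIotaE2\<close>.\<close>

lemma iIota_left:
  "insert F (insert G (insert (IExi (IVar 0)) (insert (ilift (IIota F G)) (ilift ` \<Gamma>)))) \<turnstile>\<^sub>i ilift C
    \<Longrightarrow> insert (IIota F G) \<Gamma> \<turnstile>\<^sub>i C"
  by (rule iIotaE1[OF iassm_insert]) (erule imono, blast)

lemma iAnd_cong: "\<Gamma> \<turnstile>\<^sub>i IIff A A' \<Longrightarrow> \<Gamma> \<turnstile>\<^sub>i IIff B B' \<Longrightarrow> \<Gamma> \<turnstile>\<^sub>i IIff (IAnd A B) (IAnd A' B')"
  by (meson iIffI iIffE1 iIffE2 iAnd_iff iassm_insert iweaken)

lemma iOr_cong: "\<Gamma> \<turnstile>\<^sub>i IIff A A' \<Longrightarrow> \<Gamma> \<turnstile>\<^sub>i IIff B B' \<Longrightarrow> \<Gamma> \<turnstile>\<^sub>i IIff (IOr A B) (IOr A' B')"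
proof -
  have "insert (IOr A B) \<Gamma> \<turnstile>\<^sub>i IOr A' B'"
    if "\<Gamma> \<turnstile>\<^sub>i IIff A A'" "\<Gamma> \<turnstile>\<^sub>i IIff B B'" for A A' B B'
    using that by (meson iOrE iOrI1 iOrI2 iIffE1 iassm_insert iweaken)
  then show "\<Gamma> \<turnstile>\<^sub>i IIff A A' \<Longrightarrow> \<Gamma> \<turnstile>\<^sub>i IIff B B' \<Longrightarrow> ?thesis"
    by (meson iIffI iIff_sym)
qed

lemma iImp_cong: "\<Gamma> \<turnstile>\<^sub>i IIff A A' \<Longrightarrow> \<Gamma> \<turnstile>\<^sub>i IIff B B' \<Longrightarrow> \<Gamma> \<turnstile>\<^sub>i IIff (IImp A B) (IImp A' B')"
proof -
  have "insert (IImp A B) \<Gamma> \<turnstile>\<^sub>i IImp A' B'"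
    if "\<Gamma> \<turnstile>\<^sub>i IIff A A'" "\<Gamma> \<turnstile>\<^sub>i IIff B B'" for A A' B B'
    using that by (meson iImpE iImpI iIffE1 iIffE2 iassm_insert iweaken)
  then show "\<Gamma> \<turnstile>\<^sub>i IIff A A' \<Longrightarrow> \<Gamma> \<turnstile>\<^sub>i IIff B B' \<Longrightarrow> ?thesis"
    by (meson iIffI iIff_sym)
qed

lemma iIff_cong: "\<Gamma> \<turnstile>\<^sub>i IIff A A' \<Longrightarrow> \<Gamma> \<turnstile>\<^sub>i IIff B B' \<Longrightarrow> \<Gamma> \<turnstile>\<^sub>i IIff (IIff A B) (IIff A' B')"
  by (meson iIffI iIff_sym iIff_trans iassm_insert iweaken)

lemma iAll_cong:
  "insert (IExi (IVar 0)) (ilift ` \<Gamma>) \<turnstile>\<^sub>i IIff A A' \<Longrightarrow> \<Gamma> \<turnstile>\<^sub>i IIff (IAll A) (IAll A')"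
proof -
  have "insert (IAll A) \<Gamma> \<turnstile>\<^sub>i IAll A'"
    if "insert (IExi (IVar 0)) (ilift ` \<Gamma>) \<turnstile>\<^sub>i IIff A A'" for A A'
  proof (rule iAllI)
    let ?\<Delta> = "insert (IExi (IVar 0)) (ilift ` insert (IAll A) \<Gamma>)"
    have "?\<Delta> \<turnstile>\<^sub>i A" by (rule iAllE_0) (auto intro: iAssm)
    moreover have "?\<Delta> \<turnstile>\<^sub>i IIff A A'" using that by (rule imono) blast
    ultimately show "?\<Delta> \<turnstile>\<^sub>i A'" by (metis iIffE1)
  qed
  then show "insert (IExi (IVar 0)) (ilift ` \<Gamma>) \<turnstile>\<^sub>i IIff A A' \<Longrightarrow> ?thesis"
    by (meson iIffI iIff_sym)
qed

lemma iEx_mono: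
  "insert A (insert (IExi (IVar 0)) (ilift ` \<Gamma>)) \<turnstile>\<^sub>i A' \<Longrightarrow> insert (IEx A) \<Gamma> \<turnstile>\<^sub>i IEx A'"
  by (rule iEx_left, rule iExI_0) (auto intro: iAssm)

lemma iEx_cong:
  "insert (IExi (IVar 0)) (ilift ` \<Gamma>) \<turnstile>\<^sub>i IIff A A' \<Longrightarrow> \<Gamma> \<turnstile>\<^sub>i IIff (IEx A) (IEx A')"
  by (simp add: iIff_iff iEx_mono)

lemma iIota_cong:
  "insert (IExi (IVar 0)) (ilift ` \<Gamma>) \<turnstile>\<^sub>i IIff F F' \<Longrightarrow>
   insert (IExi (IVar 0)) (ilift ` \<Gamma>) \<turnstile>\<^sub>i IIff G G' \<Longrightarrow> \<Gamma> \<turnstile>\<^sub>i IIff (IIota F G) (IIota F' G')"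
proof -
  have "insert (IIota F G) \<Gamma> \<turnstile>\<^sub>i IIota F' G'"
    if F: "insert (IExi (IVar 0)) (ilift ` \<Gamma>) \<turnstile>\<^sub>i IIff F F'"
      and G: "insert (IExi (IVar 0)) (ilift ` \<Gamma>) \<turnstile>\<^sub>i IIff G G'" for F F' G G'
  proof (rule iIota_left)
    let ?\<Delta> = "insert F (insert G (insert (IExi (IVar 0)) (insert (ilift (IIota F G)) (ilift ` \<Gamma>))))"
    let ?\<Theta> = "insert (iren (up Suc) F') (insert (IExi (IVar 0)) (ilift ` ?\<Delta>))"
    have "insert (IExi (IVar 0)) (ilift ` \<Gamma>) \<subseteq> ?\<Delta>" by blast
    then have "?\<Delta> \<turnstile>\<^sub>i IIff F F'" "?\<Delta> \<turnstile>\<^sub>i IIff G G'" using imono[OF F] imono[OF G] by simp_all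
    then have "?\<Delta> \<turnstile>\<^sub>i F'" "?\<Delta> \<turnstile>\<^sub>i G'" by (meson iAssm iIffE1 insertCI)+
    \<comment> \<open>Index 0 is an arbitrary object that is \<open>F'\<close>, hence
      \<open>F\<close>; index 1 is the described object. The original description identifies
      them.\<close>
    moreover have "?\<Theta> \<turnstile>\<^sub>i IEq (IVar 0) (IVar 1)"
    proof (rule iIotaE2)
      show "?\<Theta> \<turnstile>\<^sub>i IIota (iren (up Suc) (iren (up Suc) F)) (iren (up Suc) (iren (up Suc) G))" by (auto intro: iAssm)
      have "?\<Theta> \<turnstile>\<^sub>i iren (up Suc) (IIff F F')"
        using F by (intro iweaken[OF iren_up_derives]) blast+
      then have "?\<Theta> \<turnstile>\<^sub>i iren (up Suc) F" by (simp) (meson iIffE2 iassm_insert)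
      then show "?\<Theta> \<turnstile>\<^sub>i iinst (IVar 0) (iren (up Suc) (iren (up Suc) F))" by simp
      show "?\<Theta> \<turnstile>\<^sub>i iinst (IVar 1) (iren (up Suc) (iren (up Suc) F))"
        unfolding iinst_1_up_Suc_up_Suc by (auto intro: iAssm)
    qed (auto intro: iAssm)
    ultimately show "?\<Delta> \<turnstile>\<^sub>i ilift (IIota F' G')"
      by (auto intro!: iIotaI[of _ "IVar 0"] intro: iAssm)
  qed
  then show "insert (IExi (IVar 0)) (ilift ` \<Gamma>) \<turnstile>\<^sub>i IIff F F' \<Longrightarrow>
    insert (IExi (IVar 0)) (ilift ` \<Gamma>) \<turnstile>\<^sub>i IIff G G' \<Longrightarrow> ?thesis"
    by (meson iIffI iIff_sym)
qed

section \<open>Identity and its substitutivity in arbitrary formulas\<close>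

lemma iEq_sym: "\<Gamma> \<turnstile>\<^sub>i IEq t u \<Longrightarrow> \<Gamma> \<turnstile>\<^sub>i IEq u t"
  using iEqE[of \<Gamma> t u "IEq (IVar 0) (ilift_tm t)"]
  by (simp add: iinst_def iEqI iADEq1)

lemma iEq_trans: "\<Gamma> \<turnstile>\<^sub>i IEq t u \<Longrightarrow> \<Gamma> \<turnstile>\<^sub>i IEq u v \<Longrightarrow> \<Gamma> \<turnstile>\<^sub>i IEq t v"
  using iEqE[of \<Gamma> u v "IEq (ilift_tm t) (IVar 0)"]
  by (simp add: iinst_def)

text \<open>Index 0 after \<open>\<sigma>\<close> marks the places where \<open>u\<close> and
  \<open>v\<close> differ. Applying \<open>\<sigma>\<close> first lets the marked variable sit
  anywhere in the formula, which is the generality needed below a binder; on atomic formulas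
  \<open>isub \<sigma> A\<close> is again atomic, so \<open>iEqE\<close> applies to it.\<close>

lemma iEq_isub_cong:
  "\<Gamma> \<turnstile>\<^sub>i IEq u v \<Longrightarrow>
   \<Gamma> \<turnstile>\<^sub>i IIff (isub (\<lambda>i. isub_tm (case_nat u IVar) (\<sigma> i)) A) (isub (\<lambda>i. isub_tm (case_nat v IVar) (\<sigma> i)) A)"
proof (induct A arbitrary: \<Gamma> u v \<sigma>)
  have atomic: "\<Gamma> \<turnstile>\<^sub>i IIff (isub (\<lambda>i. isub_tm (case_nat u IVar) (\<sigma> i)) A) (isub (\<lambda>i. isub_tm (case_nat v IVar) (\<sigma> i)) A)"
    if "\<Gamma> \<turnstile>\<^sub>i IEq u v" "iatomic A" for \<Gamma> u v \<sigma> and A :: "('a, 'b) ifm"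
    using that iEqE[of _ _ _ "isub \<sigma> A"]
    by (simp add: iinst_def isub_isub) (meson iIffI iEq_sym iassm_insert iweaken)
  have under_binder: "\<exists>\<sigma>'. iup (\<lambda>i. isub_tm (case_nat u IVar) (\<sigma> i)) = (\<lambda>i. isub_tm (case_nat (ilift_tm u) IVar) (\<sigma>' i))
      \<and> iup (\<lambda>i. isub_tm (case_nat v IVar) (\<sigma> i)) = (\<lambda>i. isub_tm (case_nat (ilift_tm v) IVar) (\<sigma>' i))"
    for u v :: "'a itm" and \<sigma>
    \<comment> \<open>The marker keeps index 0 below the binder, so the bound variable is sent to
      \<open>IVar 1\<close>, which filling in the marker brings back to 0; \<open>up Suc\<close>
      makes the same room in the other terms.\<close>
    by (rule exI[of _ "case_nat (IVar 1) (\<lambda>i. iren_tm (up Suc) (\<sigma> i))"])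
      (auto simp: fun_eq_iff iup_def isub_norm up_def intro!: isub_tm_cong split: nat.split)
  have lift: "insert (IExi (IVar 0)) (ilift ` \<Gamma>) \<turnstile>\<^sub>i IEq (ilift_tm u) (ilift_tm v)"
    if "\<Gamma> \<turnstile>\<^sub>i IEq u v" for \<Gamma> :: "('a, 'b) ifm set" and u v
    using iren_derives[OF that, of Suc] by auto
  {
    case IPred
    then show ?case by (rule atomic) simp
  next
    case IEq
    then show ?case by (rule atomic) simp
  next
    case IExi
    then show ?case by (rule atomic) simp
  next
    case IBot
    then show ?case by simp
  next
    case IAnd
    then show ?case by (simp add: iAnd_cong)
  next
    case IOr
    then show ?case by (simp add: iOr_cong)
  next
    case IImp
    then show ?case by (simp add: iImp_cong)
  next
    case IIff
    then show ?case by (simp add: iIff_cong)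
  next
    case (IAll A)
    show ?case using under_binder[of u \<sigma> v] IAll(1)[OF lift[OF IAll(2)]] by (auto intro: iAll_cong)
  next
    case (IEx A)
    show ?case using under_binder[of u \<sigma> v] IEx(1)[OF lift[OF IEx(2)]] by (auto intro: iEx_cong)
  next
    case (IIota F G)
    show ?case
      using under_binder[of u \<sigma> v] IIota(1)[OF lift[OF IIota(3)]] IIota(2)[OF lift[OF IIota(3)]]
      by (auto intro: iIota_cong)
  }
qed

lemma iEq_subst: "\<Gamma> \<turnstile>\<^sub>i IEq u v \<Longrightarrow> \<Gamma> \<turnstile>\<^sub>i iinst u A \<Longrightarrow> \<Gamma> \<turnstile>\<^sub>i iinst v A"
  using iEq_isub_cong[of \<Gamma> u v IVar A] by (simp add: iinst_def) (meson iIffE1)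

section \<open>Unique satisfaction and the Russellian analysis of the binary quantifier\<close>

text \<open>The right side of Lambert's Law with index 0 as y, strengthened by the existence of y:
  for a y that does not exist, the universal formula alone would say that nothing is
  \<open>F\<close>.\<close>

definition unique :: "('c, 'p) ifm \<Rightarrow> ('c, 'p) ifm" where
  "unique F = IAnd (IExi (IVar 0)) (IAll (IIff (iren (up Suc) F) (IEq (IVar 0) (IVar 1))))"

lemma unique_cong:
  "insert (IExi (IVar 0)) (ilift ` \<Gamma>) \<turnstile>\<^sub>i IIff F F' \<Longrightarrow>
   insert (IExi (IVar 0)) (ilift ` \<Gamma>) \<turnstile>\<^sub>i IIff (unique F) (unique F')"
proof -
  assume F: "insert (IExi (IVar 0)) (ilift ` \<Gamma>) \<turnstile>\<^sub>i IIff F F'"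
  have "insert (IExi (IVar 0)) (ilift ` insert (IExi (IVar 0)) (ilift ` \<Gamma>)) \<turnstile>\<^sub>i iren (up Suc) (IIff F F')"
    using F by (rule iren_up_derives) blast
  then show ?thesis unfolding unique_def by (auto intro!: iAnd_cong iAll_cong iIff_cong)
qed

lemma isub_unique: "isub (iup s) (unique F) = unique (isub (iup s) F)"
  by (auto simp: unique_def isub_norm iup_def up_def intro!: isub_cong split: nat.split)

lemma uniqueD: "\<Gamma> \<turnstile>\<^sub>i unique F \<Longrightarrow> \<Gamma> \<turnstile>\<^sub>i F"
proof -
  assume a: "\<Gamma> \<turnstile>\<^sub>i unique F"
  then have e: "\<Gamma> \<turnstile>\<^sub>i IExi (IVar 0)"
    and "\<Gamma> \<turnstile>\<^sub>i IAll (IIff (iren (up Suc) F) (IEq (IVar 0) (IVar 1)))"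
    by (simp_all add: unique_def iAnd_iff)
  from iAllE[OF this(2,1)] have "\<Gamma> \<turnstile>\<^sub>i IIff F (IEq (IVar 0) (IVar 0))"
    using iinst_0_up_Suc[of F] by (simp add: iinst_def)
  with iEqI[OF e] show ?thesis by (rule iIffE2[rotated])
qed

text \<open>From left to right \<open>iIotaE1\<close> provides the witness and
  \<open>iIotaE2\<close> its uniqueness; from right to left the witness serves as the term in
  \<open>iIotaI\<close>. This connects \<open>tau\<close> with \<open>russell\<close>, whose values
  contain no \<open>IIota\<close>.\<close>

lemma iIota_iff_Ex:
  fixes F :: "('c, 'p) ifm"
  shows "\<Gamma> \<turnstile>\<^sub>i IIff (IIota F G) (IEx (IAnd (unique F) G))"
proof (rule iIffI)
  let ?\<Delta> = "insert F (insert G (insert (IExi (IVar 0)) (insert (ilift (IIota F G)) (ilift ` \<Gamma>))))"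
  let ?E = "insert (IExi (IVar 0)) (ilift ` ?\<Delta>) :: ('c, 'p) ifm set"
  let ?F = "iren (up Suc) F"
  have "?\<Delta> \<turnstile>\<^sub>i IAll (IIff ?F (IEq (IVar 0) (IVar 1)))"
  proof (intro iAllI iIffI)
    show "insert ?F ?E \<turnstile>\<^sub>i IEq (IVar 0) (IVar 1)"
    proof (rule iIotaE2)
      show "insert ?F ?E \<turnstile>\<^sub>i IIota (iren (up Suc) ?F) (iren (up Suc) (iren (up Suc) G))" by (auto intro: iAssm)
      show "insert ?F ?E \<turnstile>\<^sub>i iinst (IVar 1) (iren (up Suc) ?F)" unfolding iinst_1_up_Suc_up_Suc by (auto intro: iAssm)
    qed (auto intro: iAssm)
    have "insert (IEq (IVar 0) (IVar 1)) ?E \<turnstile>\<^sub>i iinst (IVar 0) (iren (up Suc) ?F)"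
      by (rule iEq_subst[OF iEq_sym[OF iassm_insert]]) (unfold iinst_1_up_Suc_up_Suc, auto intro: iAssm)
    then show "insert (IEq (IVar 0) (IVar 1)) ?E \<turnstile>\<^sub>i ?F" by simp
  qed
  moreover have "?\<Delta> \<turnstile>\<^sub>i IExi (IVar 0)" "?\<Delta> \<turnstile>\<^sub>i G" by (rule iAssm, blast)+
  ultimately have "?\<Delta> \<turnstile>\<^sub>i IAnd (unique F) G" by (simp only: unique_def iAnd_iff)
  then show "insert (IIota F G) \<Gamma> \<turnstile>\<^sub>i IEx (IAnd (unique F) G)"
    by (intro iIota_left) (rule iExI_0, assumption, rule iAssm, blast)
next
  let ?\<Delta> = "insert (IAnd (unique F) G) (insert (IExi (IVar 0)) (ilift ` \<Gamma>))"
  let ?\<Theta> = "insert (iren (up Suc) F) (insert (IExi (IVar 0)) (ilift ` ?\<Delta>))"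
  have u: "?\<Delta> \<turnstile>\<^sub>i unique F" and G: "?\<Delta> \<turnstile>\<^sub>i G" by (meson iAndE1 iAndE2 iassm_insert)+
  have "?\<Theta> \<turnstile>\<^sub>i ilift (unique F)" using u by (rule iren_derives) auto
  then have "?\<Theta> \<turnstile>\<^sub>i ilift (IAll (IIff (iren (up Suc) F) (IEq (IVar 0) (IVar 1))))"
    by (simp add: unique_def iAnd_iff)
  then have "?\<Theta> \<turnstile>\<^sub>i IIff (iren (up Suc) F) (IEq (IVar 0) (IVar 1))"
    by (rule iAllE_0) (auto intro: iAssm)
  then have "?\<Theta> \<turnstile>\<^sub>i IEq (IVar 0) (IVar 1)" by (rule iIffE1) simp
  with uniqueD[OF u] G show "insert (IEx (IAnd (unique F) G)) \<Gamma> \<turnstile>\<^sub>i IIota F G"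
    by (intro iEx_left) (auto intro!: iIotaI[of _ "IVar 0"] intro: iAssm)
qed

text \<open>The witness for the converse is \<open>u\<close>, which in free logic must exist.
  Existence is asked for only under the assumption of the instance, so that formulas entailing the
  existence of their terms satisfy the hypothesis by themselves.\<close>

lemma iEx_one_point:
  assumes "insert (iinst u A) \<Gamma> \<turnstile>\<^sub>i IExi u"
  shows "\<Gamma> \<turnstile>\<^sub>i IIff (IEx (IAnd A (IEq (ilift_tm u) (IVar 0)))) (iinst u A)"
proof (rule iIffI)
  let ?\<Delta> = "insert (IAnd A (IEq (ilift_tm u) (IVar 0))) (insert (IExi (IVar 0)) (ilift ` \<Gamma>))"
  have "?\<Delta> \<turnstile>\<^sub>i IEq (IVar 0) (ilift_tm u)" "?\<Delta> \<turnstile>\<^sub>i iinst (IVar 0) (iren (up Suc) A)"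
    by (simp_all) (meson iAndE1 iAndE2 iEq_sym iassm_insert)+
  then have "?\<Delta> \<turnstile>\<^sub>i iinst (ilift_tm u) (iren (up Suc) A)" by (rule iEq_subst)
  also have "iinst (ilift_tm u) (iren (up Suc) A) = ilift (iinst u A)"
    by (auto simp: isub_norm up_def intro!: isub_cong split: nat.split)
  finally show "insert (IEx (IAnd A (IEq (ilift_tm u) (IVar 0)))) \<Gamma> \<turnstile>\<^sub>i iinst u A"
    by (rule iEx_left)
next
  show "insert (iinst u A) \<Gamma> \<turnstile>\<^sub>i IEx (IAnd A (IEq (ilift_tm u) (IVar 0)))"
    using assms iEqI[OF assms]
    by (intro iExI[of _ u]) (auto simp: iAnd_iff iinst_def)
qed

section \<open>Russellian reading of arbitrary formulas with description terms\<close>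

(* Ex x1 (D1 & ... Ex xn (Dn & P us x1 ... xn) ...), where the value xi is index 0 in Di. *)
fun pred_at :: "'p \<Rightarrow> 'c itm list \<Rightarrow> ('c, 'p) ifm list \<Rightarrow> ('c, 'p) ifm" where
  "pred_at p us [] = IPred p us"
| "pred_at p us (D # Ds) = IEx (IAnd D (pred_at p (map ilift_tm us @ [IVar 0]) (map (iren (up Suc)) Ds)))"

(* In denotes, index 0 is the value of the term and the variables of the term are shifted by one. *)
primrec denotes :: "('c, 'p) ltm \<Rightarrow> ('c, 'p) ifm"
  and russell :: "('c, 'p) lfm \<Rightarrow> ('c, 'p) ifm" where
  "denotes (LVar i) = IEq (IVar (Suc i)) (IVar 0)"
| "denotes (LCon c) = IEq (ICon c) (IVar 0)"
| "denotes (The A) = unique (russell A)"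
| "russell (LPred p ts) = pred_at p [] (map denotes ts)"
| "russell (LEq s t) = IEx (IAnd (denotes s) (denotes t))"
| "russell (LExi t) = IEx (denotes t)"
| "russell LBot = IBot"
| "russell (LAnd A B) = IAnd (russell A) (russell B)"
| "russell (LOr A B) = IOr (russell A) (russell B)"
| "russell (LImp A B) = IImp (russell A) (russell B)"
| "russell (LIff A B) = IIff (russell A) (russell B)"
| "russell (LAll A) = IAll (russell A)"
| "russell (LEx A) = IEx (russell A)"
| "russell (LDelta B t) = IEx (IAnd (denotes t) (russell B))"

text \<open>Induction is on the length of the list because \<open>pred_at\<close> recurses on a
  renamed tail.\<close>

lemma isub_pred_at:
  fixes Ds :: "('c, 'p) ifm list"
  shows "isub s (pred_at p us Ds) = pred_at p (map (isub_tm s) us) (map (isub (iup s)) Ds)"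
proof (induct Ds arbitrary: s us rule: length_induct)
  case (1 Ds)
  show ?case
  proof (cases Ds)
    case (Cons D Es)
    have "isub (iup (iup s)) (iren (up Suc) E) = iren (up Suc) (isub (iup s) E)" for E :: "('c, 'p) ifm"
      by (auto simp: isub_norm iup_def up_def intro!: isub_cong split: nat.split)
    with 1 Cons show ?thesis by (simp add: isub_tm_iup_ilift_tm comp_def)
  qed simp
qed

lemma denotes_russell_ren:
  fixes t :: "('c, 'p) ltm" and A :: "('c, 'p) lfm"
  shows "denotes (lren_tm r t) = iren (up r) (denotes t)"
    and "russell (lren r A) = iren r (russell A)"
proof (induct t and A arbitrary: r and r rule: ltm.induct lfm.induct)
  case (The A)
  then show ?case by (simp add: iren_eq_isub isub_unique flip: iup_ren)
next
  case (LPred p ts)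
  then show ?case by (simp add: iren_eq_isub isub_pred_at iup_ren cong: map_cong)
qed simp_all

lemma pred_at_cong:
  fixes \<Gamma> :: "('c, 'p) ifm set"
  shows "list_all2 (\<lambda>D E. insert (IExi (IVar 0)) (ilift ` \<Gamma>) \<turnstile>\<^sub>i IIff D E) Ds Es \<Longrightarrow>
   \<Gamma> \<turnstile>\<^sub>i IIff (pred_at p us Ds) (pred_at p us Es)"
proof (induct Ds arbitrary: \<Gamma> us Es rule: length_induct)
  case (1 Ds)
  show ?case
  proof (cases Ds)
    case Nil
    with 1 show ?thesis by simp
  next
    case (Cons D Ds')
    with 1 obtain E Es' where Es: "Es = E # Es'"
      and D: "insert (IExi (IVar 0)) (ilift ` \<Gamma>) \<turnstile>\<^sub>i IIff D E"
      and Ds: "list_all2 (\<lambda>D E. insert (IExi (IVar 0)) (ilift ` \<Gamma>) \<turnstile>\<^sub>i IIff D E) Ds' Es'"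
      by (auto simp: list_all2_Cons1)
    let ?\<Delta> = "insert (IExi (IVar 0)) (ilift ` \<Gamma>) :: ('c, 'p) ifm set"
    have "insert (IExi (IVar 0)) (ilift ` ?\<Delta>) \<turnstile>\<^sub>i iren (up Suc) (IIff D E)"
      if "?\<Delta> \<turnstile>\<^sub>i IIff D E" for D E
      using that by (rule iren_up_derives) blast
    with Ds have "list_all2 (\<lambda>D E. insert (IExi (IVar 0)) (ilift ` ?\<Delta>) \<turnstile>\<^sub>i IIff D E)
        (map (iren (up Suc)) Ds') (map (iren (up Suc)) Es')"
      by (auto simp: list_all2_conv_all_nth)
    with 1 Cons D show ?thesis by (auto simp: Es intro!: iEx_cong iAnd_cong)
  qed
qed

text \<open>This is what validates the rule AD: the quantifier prefix already asserts a value for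
  every argument.\<close>

lemma pred_at_strict: "D \<in> set Ds \<Longrightarrow> \<Gamma> \<turnstile>\<^sub>i pred_at p us Ds \<Longrightarrow> \<Gamma> \<turnstile>\<^sub>i IEx D"
proof (induct Ds arbitrary: \<Gamma> us D rule: length_induct)
  case (1 Ds)
  then obtain E Es where Ds: "Ds = E # Es" by (cases Ds) auto
  let ?P = "pred_at p (map ilift_tm us @ [IVar 0]) (map (iren (up Suc)) Es)"
  have "insert (IEx (IAnd E ?P)) \<Gamma> \<turnstile>\<^sub>i IEx D"
  proof (cases "D = E")
    case True
    then show ?thesis by (metis iEx_mono iAndE1 iassm_insert)
  next
    case False
    then have "iren (up Suc) D \<in> set (map (iren (up Suc)) Es)" using 1 Ds by auto
    moreover have "insert (IAnd E ?P) (insert (IExi (IVar 0)) (ilift ` \<Gamma>)) \<turnstile>\<^sub>i ?P"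
      by (rule iAndE2[OF iassm_insert])
    ultimately have "insert (IAnd E ?P) (insert (IExi (IVar 0)) (ilift ` \<Gamma>)) \<turnstile>\<^sub>i IEx (iren (up Suc) D)"
      using 1(1)[rule_format, of "map (iren (up Suc)) Es"] Ds by simp
    then show ?thesis by (intro iEx_left) simp
  qed
  with 1(3) Ds show ?case by (auto intro: icut)
qed

text \<open>The quantified variable joins the known arguments \<open>us\<close>, the induction
  hypothesis clears the rest of the prefix below the quantifier, and the one-point rule puts
  \<open>t\<close> in place of the variable. The existence of \<open>t\<close> comes from
  AD.\<close>

lemma pred_at_simple:
  fixes p :: 'p and ts :: "'c itm list"
  shows "\<Gamma> \<turnstile>\<^sub>i IIff (pred_at p us (map (\<lambda>t. IEq (ilift_tm t) (IVar 0)) ts)) (IPred p (us @ ts))"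
proof (induct "length ts" arbitrary: \<Gamma> us ts)
  case (Suc n)
  then obtain t ts' where ts: "ts = t # ts'" and n: "n = length ts'" by (cases ts) auto
  let ?eq = "\<lambda>t. IEq (ilift_tm t) (IVar 0) :: ('c, 'p) ifm"
  let ?P = "pred_at p (map ilift_tm us @ [IVar 0]) (map ?eq (map ilift_tm ts'))"
  let ?Q = "IPred p ((map ilift_tm us @ [IVar 0]) @ map ilift_tm ts')"
  have "map (iren (up Suc)) (map ?eq ts') = map ?eq (map ilift_tm ts')"
    by (auto simp: isub_norm)
  then have "pred_at p us (map ?eq ts) = IEx (IAnd (?eq t) ?P)"
    unfolding ts by (simp only: list.map pred_at.simps)
  moreover have "\<Gamma> \<turnstile>\<^sub>i IIff (IEx (IAnd (?eq t) ?P)) (IEx (IAnd ?Q (?eq t)))"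
    by (intro iEx_cong iIff_trans[OF iAnd_cong iAnd_commute] iIff_refl Suc(1)) (simp add: n)
  moreover have "iinst t ?Q = IPred p (us @ ts)" by (simp add: ts iinst_def comp_def)
  moreover have "insert (IPred p (us @ ts)) \<Gamma> \<turnstile>\<^sub>i IExi t" by (rule iAD[OF iassm_insert]) (simp add: ts)
  ultimately show ?case using iEx_one_point[of t ?Q \<Gamma>] by (auto intro: iIff_trans)
qed simp

(* A biconditional rather than "u is the value of t", so that a variable represents itself even
   where it is not known to denote. *)
definition represents :: "('c, 'p) ifm set \<Rightarrow> ('c, 'p) ltm \<Rightarrow> 'c itm \<Rightarrow> bool" where
  "represents \<Gamma> t u \<longleftrightarrow> insert (IExi (IVar 0)) (ilift ` \<Gamma>) \<turnstile>\<^sub>i IIff (denotes t) (IEq (ilift_tm u) (IVar 0))"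

lemma represents_lift:
  "represents \<Gamma> t u \<Longrightarrow> represents (insert (IExi (IVar 0)) (ilift ` \<Gamma>)) (llift_tm t) (ilift_tm u)"
  unfolding represents_def
  by (drule iren_up_derives[where \<Delta> = "insert (IExi (IVar 0)) (ilift ` \<Gamma>)"], blast)
    (simp add: denotes_russell_ren iren_tm_eq_isub_tm isub_tm_isub_tm)

lemma represents_LVar: "represents \<Gamma> (LVar i) (IVar i)"
  by (simp add: represents_def)

lemma represents_lup:
  "(\<And>i. represents \<Gamma> (\<sigma> i) (\<rho> i)) \<Longrightarrow>
   represents (insert (IExi (IVar 0)) (ilift ` \<Gamma>)) (lup \<sigma> i) (iup \<rho> i)"
  by (cases i) (simp_all add: lup_def represents_LVar represents_lift)

text \<open>The substitution \<open>\<sigma>\<close> puts in terms and \<open>\<rho>\<close> the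
  simple terms representing them. Below a binder the new variable represents itself and the other
  pairs are weakened (\<open>represents_lup\<close>), so the induction goes through with both
  running in parallel.\<close>

lemma denotes_russell_sub:
  fixes t :: "('c, 'p) ltm" and A :: "('c, 'p) lfm"
  shows "(\<And>i. represents \<Gamma> (\<sigma> i) (\<rho> i)) \<Longrightarrow>
    insert (IExi (IVar 0)) (ilift ` \<Gamma>) \<turnstile>\<^sub>i IIff (denotes (lsub_tm \<sigma> t)) (isub (iup \<rho>) (denotes t))"
    and "(\<And>i. represents \<Gamma> (\<sigma> i) (\<rho> i)) \<Longrightarrow> \<Gamma> \<turnstile>\<^sub>i IIff (russell (lsub \<sigma> A)) (isub \<rho> (russell A))"
proof (induct t and A arbitrary: \<Gamma> \<sigma> \<rho> and \<Gamma> \<sigma> \<rho> rule: ltm.induct lfm.induct)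
  case (LVar i)
  then show ?case by (simp add: represents_def)
next
  case (The A)
  then show ?case by (simp add: isub_unique unique_cong represents_lup)
next
  case (LPred p ts)
  then show ?case
    by (auto simp: isub_pred_at list_all2_conv_all_nth intro!: pred_at_cong)
qed (simp_all add: iAnd_cong iOr_cong iImp_cong iIff_cong iAll_cong iEx_cong represents_lup)

section \<open>Substitution for description terms\<close>

lemma lup_simps [simp]: "lup s 0 = LVar 0" "lup s (Suc i) = lren_tm Suc (s i)"
  by (simp_all add: lup_def)

lemma lup_ren: "lup (\<lambda>i. LVar (r i)) = (\<lambda>i. LVar (up r i))"
  by (rule ext, rename_tac i, case_tac i) simp_all

lemma lup_LVar: "lup LVar = LVar"
  by (rule ext, rename_tac i, case_tac i) simp_all

lemma lren_eq_lsub: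
  fixes t :: "('c, 'p) ltm" and A :: "('c, 'p) lfm"
  shows "lren_tm r t = lsub_tm (\<lambda>i. LVar (r i)) t" and "lren r A = lsub (\<lambda>i. LVar (r i)) A"
  by (induct t and A arbitrary: r and r rule: ltm.induct lfm.induct) (simp_all add: lup_ren)

text \<open>Here terms contain formulas, so composing substitutions already needs the lifted
  functions to compose. The two mixed laws of renaming and substitution come first and yield
  \<open>lup_comp\<close>.\<close>

lemma lsub_lren:
  fixes t :: "('c, 'p) ltm" and A :: "('c, 'p) lfm"
  shows "lsub_tm s (lren_tm r t) = lsub_tm (\<lambda>i. s (r i)) t" and "lsub s (lren r A) = lsub (\<lambda>i. s (r i)) A"
proof (induct t and A arbitrary: s r and s r rule: ltm.induct lfm.induct)
  have lup_up: "(\<lambda>i. lup s (up r i)) = lup (\<lambda>i. s (r i))" for s :: "nat \<Rightarrow> ('c, 'p) ltm" and r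
    by (rule ext, rename_tac i, case_tac i) simp_all
  {
    case (The A)
    then show ?case by (simp add: lup_up)
  next
    case (LAll A)
    then show ?case by (simp add: lup_up)
  next
    case (LEx A)
    then show ?case by (simp add: lup_up)
  next
    case (LDelta B t)
    then show ?case by (simp add: lup_up)
  }
qed simp_all

lemma lren_lsub:
  fixes t :: "('c, 'p) ltm" and A :: "('c, 'p) lfm"
  shows "lren_tm r (lsub_tm s t) = lsub_tm (\<lambda>i. lren_tm r (s i)) t"
    and "lren r (lsub s A) = lsub (\<lambda>i. lren_tm r (s i)) A"
proof (induct t and A arbitrary: s r and s r rule: ltm.induct lfm.induct)
  have up_lup: "(\<lambda>i. lren_tm (up r) (lup s i)) = lup (\<lambda>i. lren_tm r (s i))"
    for s :: "nat \<Rightarrow> ('c, 'p) ltm" and r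
    by (rule ext, rename_tac i, case_tac i) (simp_all add: lren_eq_lsub(1) lsub_lren(1)[unfolded lren_eq_lsub(1)])
  {
    case (The A)
    then show ?case by (simp add: up_lup)
  next
    case (LAll A)
    then show ?case by (simp add: up_lup)
  next
    case (LEx A)
    then show ?case by (simp add: up_lup)
  next
    case (LDelta B t)
    then show ?case by (simp add: up_lup)
  }
qed simp_all

lemma lup_comp: "lup (\<lambda>i. lsub_tm s (s' i)) = (\<lambda>i. lsub_tm (lup s) (lup s' i))"
  by (rule ext, rename_tac i, case_tac i) (simp_all add: lsub_lren lren_lsub)

lemma lsub_lsub:
  fixes t :: "('c, 'p) ltm" and A :: "('c, 'p) lfm"
  shows "lsub_tm s (lsub_tm s' t) = lsub_tm (\<lambda>i. lsub_tm s (s' i)) t"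
    and "lsub s (lsub s' A) = lsub (\<lambda>i. lsub_tm s (s' i)) A"
  by (induct t and A arbitrary: s s' and s s' rule: ltm.induct lfm.induct) (simp_all add: lup_comp)

lemma lsub_LVar:
  fixes t :: "('c, 'p) ltm" and A :: "('c, 'p) lfm"
  shows "lsub_tm LVar t = t" and "lsub LVar A = A"
  by (induct t and A rule: ltm.induct lfm.induct) (simp_all add: lup_LVar map_idI)

lemmas lsub_norm = linst_def lren_eq_lsub lsub_lsub

lemma lsub_cong: "(\<And>i. s i = s' i) \<Longrightarrow> lsub s A = lsub s' A"
  by (metis ext)

lemma lsub_tm_cong: "(\<And>i. s i = s' i) \<Longrightarrow> lsub_tm s t = lsub_tm s' t"
  by (metis ext)

lemma lsub_idI: "(\<And>i. s i = LVar i) \<Longrightarrow> lsub s A = A"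
  by (metis ext lsub_LVar(2))

lemma lsub_tm_idI: "(\<And>i. s i = LVar i) \<Longrightarrow> lsub_tm s t = t"
  by (metis ext lsub_LVar(1))

section \<open>Soundness of the Russellian reading\<close>

lemma denotes_strict: "\<Gamma> \<turnstile>\<^sub>i denotes t \<Longrightarrow> \<Gamma> \<turnstile>\<^sub>i IExi (IVar 0)"
  by (cases t) (auto simp: unique_def iAnd_iff intro: iADEq2)

lemma iren_unique: "iren (up r) (unique F) = unique (iren (up r) F)"
  by (simp add: iren_eq_isub isub_unique flip: iup_ren)

text \<open>Index 1 is the value given by the hypothesis, index 0 a competitor. For a description
  the competitor satisfies the body by \<open>uniqueD\<close>, and the uniqueness clause of the
  given value identifies the two. The biconditional is the form that \<open>represents\<close> asks
  for.\<close>

lemma denotes_functional: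
  assumes 1: "\<Gamma> \<turnstile>\<^sub>i ilift (denotes t)"
  shows "\<Gamma> \<turnstile>\<^sub>i IIff (iren (up Suc) (denotes t)) (IEq (IVar 1) (IVar 0))"
proof (rule iIffI)
  let ?D = "iren (up Suc) (denotes t)"
  have simple: "insert (IEq s (IVar 0)) \<Gamma> \<turnstile>\<^sub>i IEq (IVar (Suc 0)) (IVar 0)" if "\<Gamma> \<turnstile>\<^sub>i IEq s (IVar (Suc 0))" for s
    using that by (meson iEq_sym iEq_trans iassm_insert iweaken)
  show "insert ?D \<Gamma> \<turnstile>\<^sub>i IEq (IVar 1) (IVar 0)"
  proof (cases t)
    case (The A)
    let ?F = "russell A"
    have D: "insert ?D \<Gamma> \<turnstile>\<^sub>i unique (iren (up Suc) ?F)"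
      using The by (simp add: iren_unique)
    have "insert ?D \<Gamma> \<turnstile>\<^sub>i ilift (IAll (IIff (iren (up Suc) ?F) (IEq (IVar 0) (IVar 1))))"
      using iweaken[OF 1] The by (simp add: unique_def iAnd_iff)
    moreover have "insert ?D \<Gamma> \<turnstile>\<^sub>i IExi (IVar 0)" using D by (simp add: unique_def iAnd_iff)
    ultimately have "insert ?D \<Gamma> \<turnstile>\<^sub>i IIff (iren (up Suc) ?F) (IEq (IVar 0) (IVar 1))"
      by (rule iAllE_0)
    from iIffE1[OF this uniqueD[OF D]] show ?thesis by (rule iEq_sym)
  qed (use 1 in \<open>auto intro: simple\<close>)
  have "insert (IEq (IVar 1) (IVar 0)) \<Gamma> \<turnstile>\<^sub>i iinst (IVar 0) (iren (up Suc) ?D)"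
    using iweaken[OF 1] by (intro iEq_subst[OF iassm_insert]) (simp only: iinst_1_up_Suc_up_Suc)
  then show "insert (IEq (IVar 1) (IVar 0)) \<Gamma> \<turnstile>\<^sub>i ?D" by simp
qed

lemma russell_linst:
  assumes "\<Gamma> \<turnstile>\<^sub>i denotes t"
  shows "\<Gamma> \<turnstile>\<^sub>i IIff (ilift (russell (linst t A))) (russell A)"
proof -
  \<comment> \<open>Instantiation by \<open>t\<close> followed by weakening past the value variable.
    As index 0 is the value of \<open>t\<close>, this substitution is represented by the
    identity.\<close>
  let ?\<sigma> = "case_nat (llift_tm t) (\<lambda>i. LVar (Suc i))"
  have "insert (IExi (IVar 0)) (ilift ` \<Gamma>) \<turnstile>\<^sub>i ilift (denotes t)"
    using assms by (rule iren_derives) blast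
  then have "represents \<Gamma> (llift_tm t) (IVar 0)"
    unfolding represents_def denotes_russell_ren by (auto dest: denotes_functional)
  then have "represents \<Gamma> (?\<sigma> i) (IVar i)" for i
    by (cases i) (simp_all add: represents_LVar)
  then have "\<Gamma> \<turnstile>\<^sub>i IIff (russell (lsub ?\<sigma> A)) (isub IVar (russell A))"
    by (rule denotes_russell_sub)
  moreover have "lsub ?\<sigma> A = llift (linst t A)"
    by (auto simp: lsub_norm intro!: lsub_cong split: nat.split)
  ultimately show ?thesis by (simp add: denotes_russell_ren isub_IVar)
qed

lemma iEx_Eq_Eq:
  "\<Gamma> \<turnstile>\<^sub>i IIff (IEx (IAnd (IEq (ilift_tm s) (IVar 0)) (IEq (ilift_tm t) (IVar 0)))) (IEq s t)"
  using iEx_one_point[of t "IEq (ilift_tm s) (IVar 0)" \<Gamma>]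
  by (simp add: iinst_def iADEq2[OF iassm_insert])

lemma iEx_Eq: "\<Gamma> \<turnstile>\<^sub>i IIff (IEx (IEq (ilift_tm t) (IVar 0))) (IExi t)"
proof (rule iIffI)
  show "insert (IEx (IEq (ilift_tm t) (IVar 0))) \<Gamma> \<turnstile>\<^sub>i IExi t"
    by (rule iEx_left) (simp add: iADEq1[OF iassm_insert])
  show "insert (IExi t) \<Gamma> \<turnstile>\<^sub>i IEx (IEq (ilift_tm t) (IVar 0))"
    by (rule iExI[of _ t]) (simp_all add: iinst_def iEqI)
qed

text \<open>The one-point rule at the variable itself, whose existence follows from its being a
  value.\<close>

lemma russell_LEq_LVar_0: "\<Gamma> \<turnstile>\<^sub>i IIff (russell (LEq (llift_tm t) (LVar 0))) (denotes t)"
  using iEx_one_point[of "IVar 0" "iren (up Suc) (denotes t)" \<Gamma>]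
  by (simp add: denotes_russell_ren denotes_strict[OF iassm_insert])

lemma russell_insert:
  "(\<And>B. B \<in> \<Gamma> \<Longrightarrow> \<Delta> \<turnstile>\<^sub>i russell B) \<Longrightarrow> B \<in> insert A \<Gamma> \<Longrightarrow> insert (russell A) \<Delta> \<turnstile>\<^sub>i russell B"
  by (metis iassm_insert insert_iff iweaken)

lemma russell_context:
  assumes "\<And>B. B \<in> \<Gamma> \<Longrightarrow> \<Delta> \<turnstile>\<^sub>i russell B" and "B \<in> insert (LExi (LVar 0)) (llift ` \<Gamma>)"
  shows "insert (IExi (IVar 0)) (ilift ` \<Delta>) \<turnstile>\<^sub>i russell B"
  using assms(2)
proof
  assume "B = LExi (LVar 0)"
  then show ?thesis using iIffE2[OF iEx_Eq[of _ "IVar 0"] iassm_insert] by simp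
next
  assume "B \<in> llift ` \<Gamma>"
  then obtain C where "B = llift C" "C \<in> \<Gamma>" by blast
  with iren_derives[OF assms(1), of C Suc "insert (IExi (IVar 0)) (ilift ` \<Delta>)"] show ?thesis
    by (auto simp: denotes_russell_ren)
qed

(* The premises are required to be derivable from Delta rather than to be its members.  This builds
   in a cut over the possibly infinite Gamma, with which tau replaces russell in the premises. *)
lemma russell_sound:
  "\<Gamma> \<turnstile>\<^sub>l A \<Longrightarrow> (\<And>B. B \<in> \<Gamma> \<Longrightarrow> \<Delta> \<turnstile>\<^sub>i russell B) \<Longrightarrow> \<Delta> \<turnstile>\<^sub>i russell A"
proof (induction arbitrary: \<Delta> rule: lderives.induct)
  case (lOrE \<Gamma> A B C)
  have "insert (russell A) \<Delta> \<turnstile>\<^sub>i russell C" "insert (russell B) \<Delta> \<turnstile>\<^sub>i russell C"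
    by (rule lOrE.IH, erule russell_insert[OF lOrE.prems, rotated], assumption)+
  with lOrE.IH(1)[OF lOrE.prems, unfolded russell.simps] show ?case by (rule iOrE)
next
  case (lImpI A \<Gamma> B)
  have "insert (russell A) \<Delta> \<turnstile>\<^sub>i russell B"
    by (rule lImpI.IH, erule russell_insert[OF lImpI.prems, rotated], assumption)
  then show ?case by (simp add: iImpI)
next
  case (lImpE \<Gamma> A B)
  from iImpE[OF lImpE.IH(1)[OF lImpE.prems, unfolded russell.simps] lImpE.IH(2)[OF lImpE.prems]] show ?case by simp
next
  case (lIffI A \<Gamma> B)
  have "insert (russell A) \<Delta> \<turnstile>\<^sub>i russell B" "insert (russell B) \<Delta> \<turnstile>\<^sub>i russell A"
    by (rule lIffI.IH, erule russell_insert[OF lIffI.prems, rotated], assumption)+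
  then show ?case by (simp add: iIffI)
next
  case (lIffE1 \<Gamma> A B)
  from iIffE1[OF lIffE1.IH(1)[OF lIffE1.prems, unfolded russell.simps] lIffE1.IH(2)[OF lIffE1.prems]] show ?case by simp
next
  case (lIffE2 \<Gamma> A B)
  from iIffE2[OF lIffE2.IH(1)[OF lIffE2.prems, unfolded russell.simps] lIffE2.IH(2)[OF lIffE2.prems]] show ?case by simp
next
  case (lBotE \<Gamma> A)
  \<comment> \<open>The Russellian reading of an atomic formula is compound, so the unrestricted
    form of the rule is required.\<close>
  from iExf[OF lBotE.IH[OF lBotE.prems, unfolded russell.simps]] show ?case by simp
next
  case (lAllI \<Gamma> A)
  have "insert (IExi (IVar 0)) (ilift ` \<Delta>) \<turnstile>\<^sub>i russell A"
    by (rule lAllI.IH, erule russell_context[OF lAllI.prems, rotated], assumption)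
  then show ?case by (simp add: iAllI)
next
  case (lAllE \<Gamma> A t)
  \<comment> \<open>The existence premise yields a value of \<open>t\<close>. The quantifier is
    instantiated at this value, and \<open>russell_linst\<close> passes from the value to
    \<open>t\<close>.\<close>
  let ?\<Theta> = "insert (denotes t) (insert (IExi (IVar 0)) (ilift ` \<Delta>))"
  have "?\<Theta> \<turnstile>\<^sub>i ilift (IAll (russell A))"
    using lAllE.IH(1)[OF lAllE.prems] by (intro iren_derives) auto
  then have "?\<Theta> \<turnstile>\<^sub>i russell A" by (rule iAllE_0) (simp add: iweaken)
  with russell_linst have "?\<Theta> \<turnstile>\<^sub>i ilift (russell (linst t A))" by (rule iIffE2) simp
  with lAllE.IH(2)[OF lAllE.prems, unfolded russell.simps] show ?case
    unfolding russell.simps by (rule iExE)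
next
  case (lExI \<Gamma> t A)
  let ?\<Theta> = "insert (denotes t) (insert (IExi (IVar 0)) (ilift ` \<Delta>))"
  have "?\<Theta> \<turnstile>\<^sub>i ilift (russell (linst t A))"
    using lExI.IH(1)[OF lExI.prems] by (intro iren_derives) auto
  with russell_linst have "?\<Theta> \<turnstile>\<^sub>i russell A" by (rule iIffE1) simp
  then have "?\<Theta> \<turnstile>\<^sub>i ilift (IEx (russell A))" by (rule iExI_0) (simp add: iweaken)
  with lExI.IH(2)[OF lExI.prems, unfolded russell.simps] show ?case
    unfolding russell.simps by (rule iExE)
next
  case (lExE \<Gamma> A C)
  let ?\<Theta> = "insert (russell A) (insert (IExi (IVar 0)) (ilift ` \<Delta>))"
  have "?\<Theta> \<turnstile>\<^sub>i russell (llift C)"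
    by (rule lExE.IH(2), erule russell_insert[rotated], erule russell_context[OF lExE.prems, rotated], assumption)
  with lExE.IH(1)[OF lExE.prems, unfolded russell.simps] show ?case
    unfolding denotes_russell_ren by (rule iExE)
next
  case (lEqI \<Gamma> t)
  have "\<Delta> \<turnstile>\<^sub>i IIff (IEx (denotes t)) (IEx (IAnd (denotes t) (denotes t)))"
    by (intro iEx_cong) (simp add: iIff_iff iAnd_iff iAnd_left)
  from iIffE1[OF this lEqI.IH[OF lEqI.prems, unfolded russell.simps]] show ?case by simp
next
  case (lEqE \<Gamma> t u A)
  \<comment> \<open>A single value serves both terms, and at it both instances are equivalent to
    \<open>russell A\<close>.\<close>
  let ?\<Theta> = "insert (IAnd (denotes t) (denotes u)) (insert (IExi (IVar 0)) (ilift ` \<Delta>))"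
  have "?\<Theta> \<turnstile>\<^sub>i denotes t" "?\<Theta> \<turnstile>\<^sub>i denotes u" by (meson iAndE1 iAndE2 iassm_insert)+
  then have "?\<Theta> \<turnstile>\<^sub>i IIff (ilift (russell (linst t A))) (ilift (russell (linst u A)))"
    by (meson russell_linst iIff_sym iIff_trans)
  moreover have "?\<Theta> \<turnstile>\<^sub>i ilift (russell (linst t A))"
    using lEqE.IH(2)[OF lEqE.prems] by (intro iren_derives) auto
  ultimately have "?\<Theta> \<turnstile>\<^sub>i ilift (russell (linst u A))" by (rule iIffE1)
  with lEqE.IH(1)[OF lEqE.prems, unfolded russell.simps] show ?case
    unfolding russell.simps by (rule iExE)
next
  case (lAD \<Gamma> p ts t)
  then have "\<Delta> \<turnstile>\<^sub>i pred_at p [] (map denotes ts)" by simp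
  from pred_at_strict[OF _ this] lAD(2) show ?case by simp
next
  case (lADEq1 \<Gamma> t u)
  have "insert (IEx (IAnd (denotes t) (denotes u))) \<Delta> \<turnstile>\<^sub>i IEx (denotes t)"
    by (intro iEx_mono iAnd_left) simp
  from icut[OF lADEq1.IH[OF lADEq1.prems, unfolded russell.simps] this] show ?case by simp
next
  case (lADEq2 \<Gamma> t u)
  have "insert (IEx (IAnd (denotes t) (denotes u))) \<Delta> \<turnstile>\<^sub>i IEx (denotes u)"
    by (intro iEx_mono iAnd_left) (simp add: iweaken)
  from icut[OF lADEq2.IH[OF lADEq2.prems, unfolded russell.simps] this] show ?case by simp
next
  case (lLL \<Gamma> A)
  let ?\<Theta> = "insert (IExi (IVar 0)) (ilift ` \<Delta>)"
  let ?F = "russell A"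
  \<comment> \<open>Taking y itself as the value merges it with the y that may already occur in
    \<open>A\<close>. The result is the right side of Lambert's Law up to the existence of y, which
    is assumed, and the Russellian reading of the identity x = y.\<close>
  have "iinst (IVar 0) (unique ?F) = IAnd (IExi (IVar 0)) (IAll (IIff ?F (IEq (IVar 0) (IVar 1))))"
    by (auto simp: unique_def isub_norm iup_def up_def intro!: isub_idI split: nat.split)
  then have "?\<Theta> \<turnstile>\<^sub>i IIff (IEx (IAnd (unique ?F) (IEq (IVar 1) (IVar 0))))
      (IAnd (IExi (IVar 0)) (IAll (IIff ?F (IEq (IVar 0) (IVar 1)))))"
    using iEx_one_point[of "IVar 0" "unique ?F" ?\<Theta>] by (simp add: iweaken)
  moreover have "?\<Theta> \<turnstile>\<^sub>i IIff (IAnd (IExi (IVar 0)) X) X" for X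
    by (simp add: iIff_iff iAnd_iff iAnd_left iweaken)
  moreover have "?\<Theta> \<turnstile>\<^sub>i IIff (IAll (IIff ?F (IEq (IVar 0) (IVar 1))))
      (IAll (IIff ?F (IEx (IAnd (IEq (IVar 1) (IVar 0)) (IEq (IVar 2) (IVar 0))))))"
    using iEx_Eq_Eq[of _ "IVar 0" "IVar 1"]
    by (intro iAll_cong iIff_cong) (auto simp: numeral_2_eq_2 intro: iIff_sym)
  ultimately have "?\<Theta> \<turnstile>\<^sub>i IIff (IEx (IAnd (unique ?F) (IEq (IVar 1) (IVar 0))))
      (IAll (IIff ?F (IEx (IAnd (IEq (IVar 1) (IVar 0)) (IEq (IVar 2) (IVar 0))))))"
    by (meson iIff_trans)
  then show ?case by (simp add: iAllI numeral_2_eq_2)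
next
  case (lDeltaT \<Gamma> B t)
  let ?l = "IEx (IAnd (denotes t) (russell B))" and ?r = "IAnd (IEx (denotes t)) (russell (linst t B))"
  let ?X = "insert (IAnd (denotes t) (russell B)) (insert (IExi (IVar 0)) (ilift ` \<Delta>))"
  let ?Y = "insert (denotes t) (insert (IExi (IVar 0)) (ilift ` insert ?r \<Delta>))"
  have X: "?X \<turnstile>\<^sub>i denotes t" "?X \<turnstile>\<^sub>i russell B" "?X \<turnstile>\<^sub>i IExi (IVar 0)"
    by (meson iAndE1 iAndE2 iassm_insert iweaken)+
  have "?X \<turnstile>\<^sub>i ilift (IEx (denotes t))" by (rule iExI_0[OF X(1,3)])
  moreover have "?X \<turnstile>\<^sub>i ilift (russell (linst t B))" by (rule iIffE2[OF russell_linst[OF X(1)] X(2)])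
  ultimately have "insert ?l \<Delta> \<turnstile>\<^sub>i ?r" by (intro iEx_left) (simp add: iAnd_iff)
  moreover have "?Y \<turnstile>\<^sub>i ilift ?r" by (rule iAssm) blast
  then have "?Y \<turnstile>\<^sub>i ilift (russell (linst t B))" by (simp add: iAnd_iff)
  then have "?Y \<turnstile>\<^sub>i russell B" by (rule iIffE1[OF russell_linst[OF iassm_insert]])
  then have "?Y \<turnstile>\<^sub>i IAnd (denotes t) (russell B)" by (simp add: iAnd_iff)
  then have "?Y \<turnstile>\<^sub>i ilift ?l" by (rule iExI_0) (simp add: iweaken)
  then have "insert ?r \<Delta> \<turnstile>\<^sub>i ?l" by (rule iExE[rotated]) (meson iAndE1 iassm_insert)
  ultimately show ?case by (simp add: iIffI)
next
  case (lDeltaIota \<Gamma> B A)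
  have "\<Delta> \<turnstile>\<^sub>i IIff (IEx (IAnd (denotes (The A)) (russell B)))
      (IEx (IAnd (russell (LEq (llift_tm (The A)) (LVar 0))) (russell B)))"
    by (intro iEx_cong iAnd_cong iIff_refl iIff_sym[OF russell_LEq_LVar_0])
  then show ?case by simp
qed (simp_all add: iAnd_iff iOrI1 iOrI2)

section \<open>Agreement of \<open>russell\<close> and \<open>tau\<close> on translatable
  formulas\<close>

lemma denotes_simple: "\<not> is_The t \<Longrightarrow> denotes t = IEq (ilift_tm (tau_tm t)) (IVar 0)"
  by (cases t) simp_all

text \<open>For a simple subject, \<open>tau\<close> describes it as the thing identical with
  \<open>t\<close>; this matches the condition that \<open>russell\<close> uses for its
  value.\<close>

lemma unique_Eq: "\<Gamma> \<turnstile>\<^sub>i IIff (unique (IEq (ilift_tm t) (IVar 0))) (IEq (ilift_tm t) (IVar 0))"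
proof (rule iIffI)
  show "insert (unique (IEq (ilift_tm t) (IVar 0))) \<Gamma> \<turnstile>\<^sub>i IEq (ilift_tm t) (IVar 0)"
    by (rule uniqueD) simp
  let ?\<Delta> = "insert (IEq (ilift_tm t) (IVar 0)) \<Gamma>"
  have "insert (IExi (IVar 0)) (ilift ` ?\<Delta>) \<turnstile>\<^sub>i ilift (IEq (ilift_tm t) (IVar 0))"
    by (rule iAssm) blast
  then have "insert (IExi (IVar 0)) (ilift ` ?\<Delta>)
      \<turnstile>\<^sub>i IIff (IEq (ilift_tm (ilift_tm t)) (IVar 0)) (IEq (IVar 0) (IVar 1))"
    by (intro iIffI) (simp_all, (meson iEq_sym iEq_trans iassm_insert iweaken)+)
  moreover have "iren (up Suc) (IEq (ilift_tm t) (IVar 0)) = IEq (ilift_tm (ilift_tm t)) (IVar 0)"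
    by (simp add: isub_norm)
  ultimately show "?\<Delta> \<turnstile>\<^sub>i unique (IEq (ilift_tm t) (IVar 0))"
    unfolding unique_def by (simp add: iAnd_iff iAllI iADEq2[OF iassm_insert])
qed

lemma iIota_iff_ExI:
  assumes "\<And>\<Gamma>. \<Gamma> \<turnstile>\<^sub>i IIff F F'" "\<And>\<Gamma>. \<Gamma> \<turnstile>\<^sub>i IIff G G'"
  shows "\<Gamma> \<turnstile>\<^sub>i IIff (IEx (IAnd (unique F) G)) (IIota F' G')"
  by (meson assms iIota_cong iIota_iff_Ex iIff_sym iIff_trans)

lemma russell_iff_tau_LEq:
  assumes "\<And>A \<Gamma>. s = The A \<Longrightarrow> \<Gamma> \<turnstile>\<^sub>i IIff (russell A) (tau A)"
    and "\<And>A \<Gamma>. t = The A \<Longrightarrow> \<Gamma> \<turnstile>\<^sub>i IIff (russell A) (tau A)"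
  shows "\<Gamma> \<turnstile>\<^sub>i IIff (russell (LEq s t)) (tau (LEq s t))"
proof (cases s)
  case A: (The A)
  show ?thesis
  proof (cases t)
    case B: (The B)
    \<comment> \<open>The empty context lets the renamed equivalence hold in every context.\<close>
    have "{} \<turnstile>\<^sub>i IIff (russell B) (tau B)" using assms(2) B .
    then have "\<Theta> \<turnstile>\<^sub>i iren (up Suc) (IIff (russell B) (tau B))" for \<Theta>
      by (rule iren_derives) simp
    then have "\<Theta> \<turnstile>\<^sub>i IIff (IEx (IAnd (unique (iren (up Suc) (russell B))) (IEq (IVar 1) (IVar 0))))
        (IIota (iren (up Suc) (tau B)) (IEq (IVar 1) (IVar 0)))" for \<Theta>
      by (intro iIota_iff_ExI) simp_all
    \<comment> \<open>Being the value of the second description is restated as an identity with its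
      value; this produces the inner description of \<open>tau\<close>.\<close>
    moreover have "\<Theta> \<turnstile>\<^sub>i IIff (unique (russell B))
        (IEx (IAnd (unique (iren (up Suc) (russell B))) (IEq (IVar 1) (IVar 0))))" for \<Theta>
      using iIff_sym[OF russell_LEq_LVar_0[of \<Theta> "The B"]]
      by (simp add: denotes_russell_ren iren_unique)
    ultimately have "\<Theta> \<turnstile>\<^sub>i IIff (unique (russell B))
        (IIota (iren (up Suc) (tau B)) (IEq (IVar 1) (IVar 0)))" for \<Theta>
      by (meson iIff_trans)
    with A B assms(1) show ?thesis by (auto intro!: iIota_iff_ExI)
  next
    case (LVar j)
    have "\<Theta> \<turnstile>\<^sub>i IIff (IEq (IVar (Suc j)) (IVar 0)) (IEq (IVar 0) (IVar (Suc j)))" for \<Theta>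
      by (simp add: iIff_iff iEq_sym)
    with A LVar assms(1) show ?thesis by (auto intro!: iIota_iff_ExI)
  next
    case (LCon c)
    have "\<Theta> \<turnstile>\<^sub>i IIff (IEq (ICon c) (IVar 0)) (IEq (IVar 0) (ICon c))" for \<Theta>
      by (simp add: iIff_iff iEq_sym)
    with A LCon assms(1) show ?thesis by (auto intro!: iIota_iff_ExI)
  qed
next
  case s: (LVar i)
  show ?thesis
  proof (cases t)
    case (The B)
    \<comment> \<open>The conjuncts are exchanged so that the description comes first, as in the
      Russellian form of \<open>IIota\<close>.\<close>
    with assms(2) have "\<Gamma> \<turnstile>\<^sub>i IIff (IEx (IAnd (denotes t) (denotes s))) (tau (LEq s t))"
      by (auto simp: s intro!: iIota_iff_ExI)
    then show ?thesis by (auto intro: iIff_trans[OF iEx_cong[OF iAnd_commute]])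
  qed (use s iEx_Eq_Eq[of \<Gamma> "tau_tm s" "tau_tm t"] in simp_all)
next
  case s: (LCon i)
  show ?thesis
  proof (cases t)
    case (The B)
    with assms(2) have "\<Gamma> \<turnstile>\<^sub>i IIff (IEx (IAnd (denotes t) (denotes s))) (tau (LEq s t))"
      by (auto simp: s intro!: iIota_iff_ExI)
    then show ?thesis by (auto intro: iIff_trans[OF iEx_cong[OF iAnd_commute]])
  qed (use s iEx_Eq_Eq[of \<Gamma> "tau_tm s" "tau_tm t"] in simp_all)
qed

text \<open>The term part is about the body of a description, since a description has no image of
  its own under \<open>tau_tm\<close>; the body is all that the cases of identities and abstracts
  call for.\<close>

lemma russell_iff_tau:
  fixes t :: "('c, 'p) ltm" and A :: "('c, 'p) lfm"
  shows "translatable_tm t \<Longrightarrow> t = The B \<Longrightarrow> \<Gamma> \<turnstile>\<^sub>i IIff (russell B) (tau B)"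
    and "translatable A \<Longrightarrow> \<Gamma> \<turnstile>\<^sub>i IIff (russell A) (tau A)"
proof (induct t and A arbitrary: B \<Gamma> and \<Gamma> rule: ltm.induct lfm.induct)
  case (LPred p ts)
  have "map denotes ts = map (\<lambda>t. IEq (ilift_tm t) (IVar 0)) (map tau_tm ts)"
    using LPred(2) by (simp add: denotes_simple)
  with pred_at_simple[of \<Gamma> p "[]" "map tau_tm ts"] show ?case
    by (simp only: russell.simps tau.simps append_Nil)
next
  case (LEq s t)
  then show ?case by (intro russell_iff_tau_LEq) auto
next
  case (LExi t)
  with iEx_Eq[of \<Gamma> "tau_tm t"] show ?case by (simp add: denotes_simple)
next
  case (LDelta B t)
  show ?case
  proof (cases "is_The t")
    case True
    then obtain A where "t = The A" by (cases t) simp_all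
    with LDelta show ?thesis by (auto intro!: iIota_iff_ExI)
  next
    case False
    then have "tau (LDelta B t) = IIota (IEq (ilift_tm (tau_tm t)) (IVar 0)) (tau B)"
      by (cases t) simp_all
    moreover have "\<Gamma> \<turnstile>\<^sub>i IIff (IEx (IAnd (IEq (ilift_tm (tau_tm t)) (IVar 0)) (russell B)))
        (IEx (IAnd (unique (IEq (ilift_tm (tau_tm t)) (IVar 0))) (russell B)))"
      by (intro iEx_cong iAnd_cong iIff_refl iIff_sym[OF unique_Eq])
    moreover have "\<Gamma> \<turnstile>\<^sub>i IIff (IEx (IAnd (unique (IEq (ilift_tm (tau_tm t)) (IVar 0))) (russell B)))
        (IIota (IEq (ilift_tm (tau_tm t)) (IVar 0)) (tau B))"
      using LDelta by (intro iIota_iff_ExI) simp_all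
    ultimately show ?thesis using iIff_trans False by (simp add: denotes_simple) blast
  qed
qed (simp_all add: iAnd_cong iOr_cong iImp_cong iIff_cong iAll_cong iEx_cong)

lemma tau_sound:
  assumes "\<forall>B \<in> \<Gamma>. translatable B" "translatable A" "\<Gamma> \<turnstile>\<^sub>l A"
  shows "tau ` \<Gamma> \<turnstile>\<^sub>i tau A"
proof -
  have "tau ` \<Gamma> \<turnstile>\<^sub>i russell B" if "B \<in> \<Gamma>" for B
    using russell_iff_tau(2)[of B "tau ` \<Gamma>"] assms(1) that iAssm[of "tau B" "tau ` \<Gamma>"] iIffE2
    by blast
  then have "tau ` \<Gamma> \<turnstile>\<^sub>i russell A" by (rule russell_sound[OF assms(3)])
  with russell_iff_tau(2)[OF assms(2)] show ?thesis by (rule iIffE1)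
qed

section \<open>Eliminating abstracts and description terms\<close>

lemma lsub_lup_llift: "lsub (lup s) (llift A) = llift (lsub s A)"
  by (auto simp: lsub_norm intro: lsub_cong)

lemma lsub_linst: "lsub s (linst t A) = linst (lsub_tm s t) (lsub (lup s) A)"
  by (auto simp: lsub_norm lsub_LVar intro!: lsub_cong lsub_tm_idI[symmetric] split: nat.split)

lemma lsub_tm_lup_llift_tm: "lsub_tm (lup s) (llift_tm t) = llift_tm (lsub_tm s t)"
  by (auto simp: lsub_norm intro: lsub_tm_cong)

lemma lsub_tm_inst_llift_tm [simp]: "lsub_tm (case_nat t LVar) (llift_tm u) = u"
  by (auto simp: lsub_norm intro: lsub_tm_idI)

lemma linst_0_up_Suc [simp]: "linst (LVar 0) (lren (up Suc) A) = A"
  by (auto simp: lsub_norm up_def intro!: lsub_idI split: nat.split)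

lemma latomic_lsub [simp]: "latomic (lsub s A) = latomic A"
  by (cases A) simp_all

lemma lsub_derives: "\<Gamma> \<turnstile>\<^sub>l A \<Longrightarrow> lsub s ` \<Gamma> \<subseteq> \<Delta> \<Longrightarrow> \<Delta> \<turnstile>\<^sub>l lsub s A"
proof (induction arbitrary: s \<Delta> rule: lderives.induct)
  case (lOrE \<Gamma> A B C)
  have "insert (lsub s A) \<Delta> \<turnstile>\<^sub>l lsub s C" "insert (lsub s B) \<Delta> \<turnstile>\<^sub>l lsub s C"
    using lOrE by (auto simp: subset_insertI2)
  with lOrE show ?case by (auto intro: lderives.lOrE)
next
  case (lImpI A \<Gamma> B)
  have "insert (lsub s A) \<Delta> \<turnstile>\<^sub>l lsub s B" using lImpI by (auto simp: subset_insertI2)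
  then show ?case by (auto intro: lderives.lImpI)
next
  case (lIffI A \<Gamma> B)
  have "insert (lsub s A) \<Delta> \<turnstile>\<^sub>l lsub s B" "insert (lsub s B) \<Delta> \<turnstile>\<^sub>l lsub s A"
    using lIffI by (auto simp: subset_insertI2)
  then show ?case by (auto intro: lderives.lIffI)
next
  case (lAllI \<Gamma> A)
  have "insert (LExi (LVar 0)) (llift ` \<Delta>) \<turnstile>\<^sub>l lsub (lup s) A"
    using lAllI.prems by (intro lAllI.IH) (auto simp: lsub_lup_llift)
  then show ?case by (auto intro: lderives.lAllI)
next
  case (lAllE \<Gamma> A t)
  then show ?case by (simp add: lsub_linst) (metis lderives.lAllE)
next
  case (lExI \<Gamma> t A)
  then show ?case by (simp add: lsub_linst) (metis lderives.lExI)
next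
  case (lExE \<Gamma> A C)
  have "insert (lsub (lup s) A) (insert (LExi (LVar 0)) (llift ` \<Delta>)) \<turnstile>\<^sub>l lsub (lup s) (llift C)"
    using lExE.prems by (intro lExE.IH) (auto simp: lsub_lup_llift)
  with lExE show ?case by (auto simp: lsub_lup_llift intro: lderives.lExE)
next
  case (lEqE \<Gamma> t u A)
  then show ?case by (simp add: lsub_linst) (metis lderives.lEqE latomic_lsub)
next
  case (lImpE \<Gamma> A B)
  then show ?case by simp (metis lderives.lImpE)
next
  case (lIffE1 \<Gamma> A B)
  then show ?case by simp (metis lderives.lIffE1)
next
  case (lIffE2 \<Gamma> A B)
  then show ?case by simp (metis lderives.lIffE2)
next
  case (lAD \<Gamma> p ts t)
  then show ?case by (simp, metis lderives.lAD image_eqI list.set_map)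
next
  case (lADEq1 \<Gamma> t u)
  then show ?case by simp (metis lderives.lADEq1)
next
  case (lADEq2 \<Gamma> t u)
  then show ?case by simp (metis lderives.lADEq2)
next
  case (lLL \<Gamma> A)
  \<comment> \<open>Both x and y are bound in the schema, so the substitution reaches
    \<open>A\<close> below two binders.\<close>
  show ?case using lderives.lLL[of \<Delta> "lsub (lup (lup s)) A"] by simp
next
  case (lDeltaT \<Gamma> B t)
  show ?case using lderives.lDeltaT[of \<Delta> "lsub (lup s) B" "lsub_tm s t"] by (simp add: lsub_linst)
next
  case (lDeltaIota \<Gamma> B A)
  show ?case using lderives.lDeltaIota[of \<Delta> "lsub (lup s) B" "lsub (lup s) A"]
    lsub_tm_lup_llift_tm[of s "The A"] by simp
next
  case (lAndE1 \<Gamma> A B)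
  then show ?case by simp (metis lderives.lAndE1)
next
  case (lAndE2 \<Gamma> A B)
  then show ?case by simp (metis lderives.lAndE2)
next
  case (lBotE \<Gamma> A)
  then show ?case by simp (metis lderives.lBotE latomic_lsub)
qed (auto intro: lAssm lAndI lOrI1 lOrI2 lEqI)

lemma lren_derives: "\<Gamma> \<turnstile>\<^sub>l A \<Longrightarrow> lren r ` \<Gamma> \<subseteq> \<Delta> \<Longrightarrow> \<Delta> \<turnstile>\<^sub>l lren r A"
  using lsub_derives[of \<Gamma> A "\<lambda>i. LVar (r i)" \<Delta>] by (simp add: lren_eq_lsub)

lemma lmono: "\<Gamma> \<turnstile>\<^sub>l A \<Longrightarrow> \<Gamma> \<subseteq> \<Delta> \<Longrightarrow> \<Delta> \<turnstile>\<^sub>l A"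
  using lsub_derives[of \<Gamma> A LVar \<Delta>] by (simp add: lsub_LVar)

lemma lassm_insert [simp]: "insert A \<Gamma> \<turnstile>\<^sub>l A"
  by (simp add: lAssm)

lemma lweaken: "\<Gamma> \<turnstile>\<^sub>l A \<Longrightarrow> insert B \<Gamma> \<turnstile>\<^sub>l A"
  by (erule lmono) blast

lemma lAllE_0: "\<Gamma> \<turnstile>\<^sub>l llift (LAll A) \<Longrightarrow> \<Gamma> \<turnstile>\<^sub>l LExi (LVar 0) \<Longrightarrow> \<Gamma> \<turnstile>\<^sub>l A"
  by (metis lAllE linst_0_up_Suc lren.simps(9))

lemma lExI_0: "\<Gamma> \<turnstile>\<^sub>l A \<Longrightarrow> \<Gamma> \<turnstile>\<^sub>l LExi (LVar 0) \<Longrightarrow> \<Gamma> \<turnstile>\<^sub>l llift (LEx A)"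
  by (metis lExI linst_0_up_Suc lren.simps(10))

lemma lEq_sym: "\<Gamma> \<turnstile>\<^sub>l LEq t u \<Longrightarrow> \<Gamma> \<turnstile>\<^sub>l LEq u t"
  using lEqE[of \<Gamma> t u "LEq (LVar 0) (llift_tm t)"]
  by (simp add: linst_def lEqI lADEq1)

lemma lEq_trans: "\<Gamma> \<turnstile>\<^sub>l LEq t u \<Longrightarrow> \<Gamma> \<turnstile>\<^sub>l LEq u v \<Longrightarrow> \<Gamma> \<turnstile>\<^sub>l LEq t v"
  using lEqE[of \<Gamma> u v "LEq (llift_tm t) (LVar 0)"]
  by (simp add: linst_def)

lemma lAnd_iff: "\<Gamma> \<turnstile>\<^sub>l LAnd A B \<longleftrightarrow> \<Gamma> \<turnstile>\<^sub>l A \<and> \<Gamma> \<turnstile>\<^sub>l B"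
  by (meson lAndI lAndE1 lAndE2)

(* One direction suffices, as identity is symmetric.  Under LDelta the bound variable is replaced
   by the subject t, which may itself depend on u; this is why sigma is arbitrary. *)
lemma lEq_lsub:
  "\<Gamma> \<turnstile>\<^sub>l LEq u v \<Longrightarrow> \<Gamma> \<turnstile>\<^sub>l lsub (\<lambda>i. lsub_tm (case_nat u LVar) (\<sigma> i)) A \<Longrightarrow>
   \<Gamma> \<turnstile>\<^sub>l lsub (\<lambda>i. lsub_tm (case_nat v LVar) (\<sigma> i)) A"
\<comment> \<open>Terms get the trivial predicate: \<open>lEqE\<close> replaces \<open>u\<close> by
  \<open>v\<close> throughout the terms of an atomic formula at once, bodies of descriptions
  included.\<close>
proof (induct A arbitrary: \<Gamma> u v \<sigma> rule: lfm.induct[of "\<lambda>_. True"])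
  let ?s = "\<lambda>\<sigma> u i. lsub_tm (case_nat u LVar) (\<sigma> i)"
  have atomic: "\<Gamma> \<turnstile>\<^sub>l lsub (?s \<sigma> v) A"
    if "\<Gamma> \<turnstile>\<^sub>l LEq u v" "\<Gamma> \<turnstile>\<^sub>l lsub (?s \<sigma> u) A" "latomic A"
    for \<Gamma> u v \<sigma> and A :: "('a, 'b) lfm"
    using lEqE[of \<Gamma> u v "lsub \<sigma> A"] that by (simp add: linst_def lsub_lsub)
  have under_binder: "lup (?s \<sigma> u) = ?s (case_nat (LVar 1) (\<lambda>i. lren_tm (up Suc) (\<sigma> i))) (llift_tm u)"
    for u :: "('a, 'b) ltm" and \<sigma>
    by (auto simp: fun_eq_iff lup_def lsub_norm up_def intro!: lsub_tm_cong split: nat.split)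
  have lift: "insert B (insert (LExi (LVar 0)) (llift ` \<Gamma>)) \<turnstile>\<^sub>l LEq (llift_tm u) (llift_tm v)"
    if "\<Gamma> \<turnstile>\<^sub>l LEq u v" for \<Gamma> and u v :: "('a, 'b) ltm" and B
    using lren_derives[OF that, of Suc "insert B (insert (LExi (LVar 0)) (llift ` \<Gamma>))"] by auto
  {
    case LPred
    show ?case by (rule atomic[OF LPred.prems]) simp
  next
    case LEq
    show ?case by (rule atomic[OF LEq.prems]) simp
  next
    case LExi
    show ?case by (rule atomic[OF LExi.prems]) simp
  next
    case (LAnd A B)
    have "\<Gamma> \<turnstile>\<^sub>l lsub (?s \<sigma> u) A" "\<Gamma> \<turnstile>\<^sub>l lsub (?s \<sigma> u) B"
      using LAnd.prems(2) by (simp_all add: lAnd_iff)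
    from LAnd.hyps(1)[OF LAnd.prems(1) this(1)] LAnd.hyps(2)[OF LAnd.prems(1) this(2)]
    show ?case by (simp add: lAnd_iff)
  next
    case (LOr A B)
    have "insert (lsub (?s \<sigma> u) A) \<Gamma> \<turnstile>\<^sub>l lsub (?s \<sigma> v) (LOr A B)"
      using LOr.hyps(1)[OF lweaken[OF LOr.prems(1)] lassm_insert] by (simp add: lOrI1)
    moreover have "insert (lsub (?s \<sigma> u) B) \<Gamma> \<turnstile>\<^sub>l lsub (?s \<sigma> v) (LOr A B)"
      using LOr.hyps(2)[OF lweaken[OF LOr.prems(1)] lassm_insert] by (simp add: lOrI2)
    ultimately show ?case using LOr.prems(2) unfolding lsub.simps by (rule lOrE[rotated])
  next
    case (LImp A B)
    note eq = lweaken[OF LImp.prems(1)]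
    have "insert (lsub (?s \<sigma> v) A) \<Gamma> \<turnstile>\<^sub>l lsub (?s \<sigma> u) A"
      by (rule LImp.hyps(1)[OF lEq_sym[OF eq] lassm_insert])
    then have "insert (lsub (?s \<sigma> v) A) \<Gamma> \<turnstile>\<^sub>l lsub (?s \<sigma> u) B"
      by (rule lImpE[OF lweaken[OF LImp.prems(2)[unfolded lsub.simps]]])
    from LImp.hyps(2)[OF eq this] show ?case by (simp add: lImpI)
  next
    case (LIff A B)
    note eq = lweaken[OF LIff.prems(1)]
    have "insert (lsub (?s \<sigma> v) A) \<Gamma> \<turnstile>\<^sub>l lsub (?s \<sigma> u) A"
      by (rule LIff.hyps(1)[OF lEq_sym[OF eq] lassm_insert])
    then have "insert (lsub (?s \<sigma> v) A) \<Gamma> \<turnstile>\<^sub>l lsub (?s \<sigma> u) B"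
      by (rule lIffE1[OF lweaken[OF LIff.prems(2)[unfolded lsub.simps]]])
    then have A: "insert (lsub (?s \<sigma> v) A) \<Gamma> \<turnstile>\<^sub>l lsub (?s \<sigma> v) B" by (rule LIff.hyps(2)[OF eq])
    have "insert (lsub (?s \<sigma> v) B) \<Gamma> \<turnstile>\<^sub>l lsub (?s \<sigma> u) B"
      by (rule LIff.hyps(2)[OF lEq_sym[OF eq] lassm_insert])
    then have "insert (lsub (?s \<sigma> v) B) \<Gamma> \<turnstile>\<^sub>l lsub (?s \<sigma> u) A"
      by (rule lIffE2[OF lweaken[OF LIff.prems(2)[unfolded lsub.simps]]])
    then have "insert (lsub (?s \<sigma> v) B) \<Gamma> \<turnstile>\<^sub>l lsub (?s \<sigma> v) A" by (rule LIff.hyps(1)[OF eq])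
    with A show ?case by (simp add: lIffI)
  next
    case (LAll A)
    let ?\<Delta> = "insert (LExi (LVar 0)) (insert (LExi (LVar 0)) (llift ` \<Gamma>))"
    have "?\<Delta> \<turnstile>\<^sub>l llift (lsub (?s \<sigma> u) (LAll A))" using LAll.prems(2) by (rule lren_derives) blast
    then have "?\<Delta> \<turnstile>\<^sub>l lsub (lup (?s \<sigma> u)) A" unfolding lsub.simps by (rule lAllE_0) simp
    then have "?\<Delta> \<turnstile>\<^sub>l lsub (lup (?s \<sigma> v)) A"
      unfolding under_binder by (rule LAll.hyps(1)[OF lift[OF LAll.prems(1)]])
    then show ?case by (simp add: lAllI)
  next
    case (LEx A)
    let ?\<Delta> = "insert (lsub (lup (?s \<sigma> u)) A) (insert (LExi (LVar 0)) (llift ` \<Gamma>))"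
    have "?\<Delta> \<turnstile>\<^sub>l lsub (lup (?s \<sigma> v)) A"
      unfolding under_binder by (rule LEx.hyps(1)[OF lift[OF LEx.prems(1)] lassm_insert])
    then have "?\<Delta> \<turnstile>\<^sub>l llift (lsub (?s \<sigma> v) (LEx A))"
      unfolding lsub.simps by (rule lExI_0) (simp add: lweaken)
    then show ?case by (rule lExE[OF LEx.prems(2)[unfolded lsub.simps]])
  next
    case (LDelta B t)
    let ?\<tau> = "case_nat (lsub_tm \<sigma> t) \<sigma>"
    have inst: "linst (lsub_tm (?s \<sigma> w) t) (lsub (lup (?s \<sigma> w)) B) = lsub (?s ?\<tau> w) B" for w
      by (auto simp: linst_def lsub_lsub lup_def intro!: lsub_cong split: nat.split)
    from lIffE1[OF lDeltaT LDelta.prems(2)[unfolded lsub.simps]]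
    have "\<Gamma> \<turnstile>\<^sub>l LExi (lsub_tm (?s \<sigma> u) t)" "\<Gamma> \<turnstile>\<^sub>l lsub (?s ?\<tau> u) B"
      unfolding lAnd_iff inst by blast+
    then have "\<Gamma> \<turnstile>\<^sub>l LExi (lsub_tm (?s \<sigma> v) t)" "\<Gamma> \<turnstile>\<^sub>l lsub (?s ?\<tau> v) B"
      using atomic[OF LDelta.prems(1), of \<sigma> "LExi t"] LDelta.hyps(1)[OF LDelta.prems(1), of ?\<tau>] by simp_all
    then have "\<Gamma> \<turnstile>\<^sub>l LAnd (LExi (lsub_tm (?s \<sigma> v) t)) (linst (lsub_tm (?s \<sigma> v) t) (lsub (lup (?s \<sigma> v)) B))"
      by (simp add: inst lAnd_iff)
    from lIffE2[OF lDeltaT this] show ?case by simp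
  }
qed simp_all

lemma lEq_subst: "\<Gamma> \<turnstile>\<^sub>l LEq u v \<Longrightarrow> \<Gamma> \<turnstile>\<^sub>l linst u A \<Longrightarrow> \<Gamma> \<turnstile>\<^sub>l linst v A"
  using lEq_lsub[of \<Gamma> u v LVar A] by (simp add: linst_def)

section \<open>Soundness of \<open>ups\<close>: the rules for the binary quantifier derived from the
  schemas\<close>

lemma ups_tm_ren: "ups_tm (iren_tm r t) = lren_tm r (ups_tm t)"
  by (cases t) simp_all

lemma ups_ren: "ups (iren r A) = lren r (ups A)"
  by (induct A arbitrary: r) (simp_all add: ups_tm_ren)

text \<open>In contrast to \<open>tau\<close>, the translation commutes with substitution literally,
  because only variables and constants are substituted.\<close>

lemma ups_sub: "ups (isub s A) = lsub (\<lambda>i. ups_tm (s i)) (ups A)"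
proof (induct A arbitrary: s)
  have tm: "ups_tm (isub_tm s t) = lsub_tm (\<lambda>i. ups_tm (s i)) (ups_tm t)" for s and t :: "'a itm"
    by (cases t) simp_all
  have up: "(\<lambda>i. ups_tm (iup s i)) = lup (\<lambda>i. ups_tm (s i))" for s :: "nat \<Rightarrow> 'a itm"
    by (rule ext, rename_tac i, case_tac i) (simp_all add: ups_tm_ren)
  {
    case IPred
    then show ?case by (simp add: tm)
  next
    case IEq
    then show ?case by (simp add: tm)
  next
    case IExi
    then show ?case by (simp add: tm)
  next
    case IAll
    then show ?case by (simp add: up)
  next
    case IEx
    then show ?case by (simp add: up)
  next
    case IIota
    then show ?case by (simp add: up)
  }
qed simp_all

lemma ups_inst: "ups (iinst t A) = linst (ups_tm t) (ups A)"
  by (auto simp: iinst_def linst_def ups_sub intro!: lsub_cong split: nat.split)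

lemma latomic_ups: "iatomic A \<Longrightarrow> latomic (ups A)"
  by (cases A) simp_all

lemma lLL_inst:
  "\<Gamma> \<turnstile>\<^sub>l LExi u \<Longrightarrow> \<Gamma> \<turnstile>\<^sub>l LIff (LEq (The A) u) (LAll (LIff A (LEq (LVar 0) (llift_tm u))))"
proof -
  assume "\<Gamma> \<turnstile>\<^sub>l LExi u"
  \<comment> \<open>In the schema y may occur in \<open>A\<close>. Weakening \<open>A\<close> past y
    first protects it, so that putting \<open>u\<close> for y leaves \<open>A\<close> as it
    was.\<close>
  from lAllE[OF lLL this, of "lren (up Suc) A"]
  have "\<Gamma> \<turnstile>\<^sub>l linst u (LIff (LEq (The (lren (up Suc) A)) (LVar 0))
      (LAll (LIff (lren (up Suc) A) (LEq (LVar 0) (LVar 1)))))" .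
  moreover have "lsub (lup (case_nat u LVar)) (lren (up Suc) A) = A"
    by (auto simp: lsub_norm lup_def up_def intro!: lsub_idI split: nat.split)
  ultimately show ?thesis by (simp add: linst_def)
qed

text \<open>The premises amount to the right side of Lambert's Law at \<open>t\<close>; hence the
  description is identical with \<open>t\<close>, and \<open>t\<close> is the witness for the
  existential formula of the schema for descriptions.\<close>

lemma lDelta_The_intro:
  assumes F: "\<Gamma> \<turnstile>\<^sub>l linst t F" and G: "\<Gamma> \<turnstile>\<^sub>l linst t G" and t: "\<Gamma> \<turnstile>\<^sub>l LExi t"
    and uniq: "insert F (insert (LExi (LVar 0)) (llift ` \<Gamma>)) \<turnstile>\<^sub>l LEq (LVar 0) (llift_tm t)"
  shows "\<Gamma> \<turnstile>\<^sub>l LDelta G (The F)"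
proof -
  let ?\<Delta> = "insert (LEq (LVar 0) (llift_tm t)) (insert (LExi (LVar 0)) (llift ` \<Gamma>))"
  have "?\<Delta> \<turnstile>\<^sub>l llift (linst t F)" using F by (rule lren_derives) blast
  moreover have "llift (linst t F) = linst (llift_tm t) (lren (up Suc) F)"
    by (auto simp: lsub_norm up_def intro!: lsub_cong split: nat.split)
  ultimately have "?\<Delta> \<turnstile>\<^sub>l linst (LVar 0) (lren (up Suc) F)"
    using lEq_subst[OF lEq_sym[OF lassm_insert]] by metis
  then have "\<Gamma> \<turnstile>\<^sub>l LAll (LIff F (LEq (LVar 0) (llift_tm t)))"
    using uniq by (simp add: lAllI lIffI)
  with lLL_inst[OF t] have "\<Gamma> \<turnstile>\<^sub>l LEq (The F) t" by (rule lIffE2)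
  then have "\<Gamma> \<turnstile>\<^sub>l linst t (LAnd (LEq (llift_tm (The F)) (LVar 0)) G)"
    using G lsub_tm_inst_llift_tm[of t "The F"] by (simp add: linst_def lAnd_iff)
  from lIffE2[OF lDeltaIota lExI[OF this t]] show ?thesis .
qed

text \<open>One elimination for both rules: the existential formula of the schema gives a value,
  Lambert's Law makes it the only existing \<open>F\<close>, and the self-identity of the value
  makes it an \<open>F\<close>. The uniqueness is kept as an assumption for the sake of the second
  elimination rule.\<close>

lemma lDelta_The_elim:
  assumes D: "\<Gamma> \<turnstile>\<^sub>l LDelta G (The F)"
    and C: "insert (LAll (LIff (lren (up Suc) F) (LEq (LVar 0) (LVar 1))))
      (insert F (insert G (insert (LExi (LVar 0)) (llift ` \<Gamma>)))) \<turnstile>\<^sub>l llift C"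
  shows "\<Gamma> \<turnstile>\<^sub>l C"
proof (rule lExE[OF lIffE1[OF lDeltaIota D]])
  let ?u = "LAll (LIff (lren (up Suc) F) (LEq (LVar 0) (LVar 1)))"
  let ?\<Delta> = "insert (LAnd (LEq (llift_tm (The F)) (LVar 0)) G) (insert (LExi (LVar 0)) (llift ` \<Gamma>))"
  have "?\<Delta> \<turnstile>\<^sub>l LEq (llift_tm (The F)) (LVar 0)" and G: "?\<Delta> \<turnstile>\<^sub>l G"
    by (meson lAndE1 lAndE2 lassm_insert)+
  moreover have e: "?\<Delta> \<turnstile>\<^sub>l LExi (LVar 0)" by (rule lAssm) blast
  ultimately have u: "?\<Delta> \<turnstile>\<^sub>l ?u"
    using lIffE1[OF lLL_inst[OF e, of "lren (up Suc) F"]] by simp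
  from lAllE[OF this e] have "?\<Delta> \<turnstile>\<^sub>l LIff F (LEq (LVar 0) (LVar 0))"
    using linst_0_up_Suc[of F] by (simp add: linst_def)
  from lIffE2[OF this lEqI[OF e]] have F: "?\<Delta> \<turnstile>\<^sub>l F" .
  have "insert ?u (insert F (insert G ?\<Delta>)) \<turnstile>\<^sub>l llift C"
    using C by (rule lmono) blast
  then have "?\<Delta> \<turnstile>\<^sub>l LImp G (LImp F (LImp ?u (llift C)))" by (intro lImpI)
  from lImpE[OF lImpE[OF lImpE[OF this G] F] u] show "?\<Delta> \<turnstile>\<^sub>l llift C" .
qed

lemma ups_sound: "\<Gamma> \<turnstile>\<^sub>i A \<Longrightarrow> ups ` \<Gamma> \<turnstile>\<^sub>l ups A"
proof (induction rule: iderives.induct)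
  case (iAndE1 \<Gamma> A B)
  then show ?case by (simp add: lAnd_iff)
next
  case (iAndE2 \<Gamma> A B)
  then show ?case by (simp add: lAnd_iff)
next
  case (iOrE \<Gamma> A B C)
  from lOrE[OF iOrE.IH[unfolded ups.simps image_insert]] show ?case .
next
  case (iImpE \<Gamma> A B)
  from lImpE[OF iImpE.IH[unfolded ups.simps]] show ?case .
next
  case (iIffE1 \<Gamma> A B)
  from lIffE1[OF iIffE1.IH[unfolded ups.simps]] show ?case .
next
  case (iIffE2 \<Gamma> A B)
  from lIffE2[OF iIffE2.IH[unfolded ups.simps]] show ?case .
next
  case (iBotE \<Gamma> A)
  from lBotE[OF iBotE.IH[unfolded ups.simps] latomic_ups] \<open>iatomic A\<close> show ?case .
next
  case (iAllI \<Gamma> A)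
  then show ?case by (simp add: image_image ups_ren lAllI)
next
  case (iAllE \<Gamma> A t)
  from lAllE[OF iAllE.IH[unfolded ups.simps]] show ?case by (simp only: ups_inst)
next
  case (iExI \<Gamma> t A)
  from lExI[OF iExI.IH[unfolded ups_inst ups.simps]] show ?case by simp
next
  case (iExE \<Gamma> A C)
  then have "insert (ups A) (insert (LExi (LVar 0)) (llift ` ups ` \<Gamma>)) \<turnstile>\<^sub>l llift (ups C)"
    by (simp add: image_image ups_ren)
  from lExE[OF iExE.IH(1)[unfolded ups.simps] this] show ?case .
next
  case (iEqE \<Gamma> t u A)
  from lEqE[OF iEqE.IH(1)[unfolded ups.simps] latomic_ups[OF \<open>iatomic A\<close>] iEqE.IH(2)[unfolded ups_inst]]
  show ?case by (simp only: ups_inst)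
next
  case (iAD \<Gamma> p ts t)
  from lAD[OF iAD.IH[unfolded ups.simps]] \<open>t \<in> set ts\<close> show ?case by simp
next
  case (iADEq1 \<Gamma> t u)
  from lADEq1[OF iADEq1.IH[unfolded ups.simps]] show ?case by simp
next
  case (iADEq2 \<Gamma> t u)
  from lADEq2[OF iADEq2.IH[unfolded ups.simps]] show ?case by simp
next
  case (iIotaI \<Gamma> t F G)
  have "insert (ups F) (insert (LExi (LVar 0)) (llift ` ups ` \<Gamma>)) \<turnstile>\<^sub>l LEq (LVar 0) (llift_tm (ups_tm t))"
    using iIotaI.IH(4) by (simp add: image_image ups_ren ups_tm_ren)
  from lDelta_The_intro[OF iIotaI.IH(1-3)[unfolded ups_inst ups.simps] this] show ?case by simp
next
  case (iIotaE1 \<Gamma> F G C)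
  have "insert (ups F) (insert (ups G) (insert (LExi (LVar 0)) (llift ` ups ` \<Gamma>))) \<turnstile>\<^sub>l llift (ups C)"
    using iIotaE1.IH(2) by (simp add: image_image ups_ren)
  from lDelta_The_elim[OF iIotaE1.IH(1)[unfolded ups.simps] lweaken[OF this]] show ?case .
next
  case (iIotaE2 \<Gamma> F G t u)
  let ?F = "ups F" and ?\<Gamma> = "ups ` \<Gamma>"
  let ?u = "LAll (LIff (lren (up Suc) ?F) (LEq (LVar 0) (LVar 1)))"
  let ?\<Delta> = "insert ?u (insert ?F (insert (ups G) (insert (LExi (LVar 0)) (llift ` ?\<Gamma>))))"
  \<comment> \<open>Uniqueness identifies each of the two terms with the described value, index 0;
    transitivity then identifies them with each other, and the value no longer occurs in the
    conclusion.\<close>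
  have eq: "?\<Delta> \<turnstile>\<^sub>l LEq (llift_tm t) (LVar 0)" if "?\<Gamma> \<turnstile>\<^sub>l LExi t" "?\<Gamma> \<turnstile>\<^sub>l linst t ?F" for t
  proof -
    have "?\<Delta> \<turnstile>\<^sub>l llift (LExi t)" using that(1) by (rule lren_derives) blast
    from lAllE[OF lassm_insert this[unfolded lren.simps]]
    have "?\<Delta> \<turnstile>\<^sub>l linst (llift_tm t) (LIff (lren (up Suc) ?F) (LEq (LVar 0) (LVar 1)))" .
    moreover have "linst (llift_tm t) (lren (up Suc) ?F) = llift (linst t ?F)"
      by (auto simp: lsub_norm up_def intro!: lsub_cong split: nat.split)
    ultimately have "?\<Delta> \<turnstile>\<^sub>l LIff (llift (linst t ?F)) (LEq (llift_tm t) (LVar 0))"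
      by (simp add: linst_def)
    moreover have "?\<Delta> \<turnstile>\<^sub>l llift (linst t ?F)" using that(2) by (rule lren_derives) blast
    ultimately show ?thesis by (rule lIffE1)
  qed
  have "?\<Delta> \<turnstile>\<^sub>l LEq (llift_tm (ups_tm t)) (llift_tm (ups_tm u))"
    using lEq_trans[OF eq lEq_sym[OF eq]] iIotaE2.IH(2-5) by (simp add: ups_inst)
  then have "?\<Delta> \<turnstile>\<^sub>l llift (LEq (ups_tm t) (ups_tm u))" by simp
  from lDelta_The_elim[OF iIotaE2.IH(1)[unfolded ups.simps] this] show ?case by simp
qed (simp_all add: lAssm lAndI lOrI1 lOrI2 lImpI lIffI lEqI)

theorem theorem2:
  shows "(\<forall>(\<Gamma> :: ('c, 'p) ifm set) A. \<Gamma> \<turnstile>\<^sub>i A \<longrightarrow> ups ` \<Gamma> \<turnstile>\<^sub>l ups A) \<and>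
    (\<forall>(\<Gamma> :: ('c, 'p) lfm set) A. (\<forall>B \<in> \<Gamma>. translatable B) \<longrightarrow> translatable A \<longrightarrow> \<Gamma> \<turnstile>\<^sub>l A \<longrightarrow> tau ` \<Gamma> \<turnstile>\<^sub>i tau A)"
  using ups_sound tau_sound by blast

end
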